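(* Let $K$ be a field and let $S$ be a finite set of absolute values on $K$, each of which is either real archimedean or ultrametric discrete. Let $K_{{\rm tot},S}$ denote the maximal extension of $K$ (inside a fixed algebraic closure $\overline{K}$) in which every element of $S$ totally splits. Then $K_{{\rm tot},S}$ is not Hilbertian.
   Context: A real archimedean absolute value on $K$ is one induced by an embedding of $K$ into $\mathbb{R}$ (equivalently, its completion is $\mathbb{R}$); an ultrametric discrete absolute value is one coming from a discrete valuation. An element $|\cdot|\in S$ totally splits in an algebraic extension $L/K$ if $L$ is contained in every Henselization of $(K,|\cdot|)$ (ultrametric case) resp. every real closure of $K$ with respect to the ordering induced by $|\cdot|$ (archimedean case), taken inside $\overline{K}$; thus $K_{{\rm tot},S}$ is the intersection of all such Henselizations and real closures for the elements of $S$. A field $F$ is Hilbertian if for every polynomial $f(Y,X)\in F(Y)[X]$ irreducible over $F(Y)$ (with $Y$ a single variable) there exist infinitely many (equivalently, at least one, after allowing finitely many exceptions to be avoided) $y\in F$ such that $f(y,X)$ is defined and irreducible over $F$; precisely: for every irreducible $f\in F[Y,X]$ separable in $X$, the set of $y\in F$ with $f(y,X)$ irreducible in $F[X]$ is nonempty (in fact infinite). *)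

theory Defs
  imports
    Complex_Main
    "HOL-Algebra.Algebraic_Closure_Type"
    "HOL-Algebra.Ring_Divisibility"
    "HOL-Computational_Algebra.Polynomial_Factorial"
begin

text \<open>
  The base field \<open>K\<close> is a type of class \<^class>\<open>field\<close>, its algebraic closure is the library type
  of algebraic closures with embedding \<^const>\<open>to_ac\<close>, and subfields of the closure are sets.
  The structure \<open>ring_on A\<close> is the subset \<open>A\<close> with the operations of the ambient type.
\<close>

abbreviation ring_on :: "'a::comm_ring_1 set \<Rightarrow> 'a ring"
  where "ring_on A \<equiv> ring_of_type_algebra\<lparr>carrier := A\<rparr>"

definition intermediate_field :: "'k::field alg_closure set \<Rightarrow> bool"
  where "intermediate_field L \<longleftrightarrow> subfield L ring_of_type_algebra \<and> range to_ac \<subseteq> L"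

definition polys_over :: "'a::zero set \<Rightarrow> 'a poly set"
  where "polys_over A = {p. \<forall>i. Polynomial.coeff p i \<in> A}"


section \<open>Absolute values\<close>

definition absolute_value :: "('k::field \<Rightarrow> real) \<Rightarrow> bool"
  where "absolute_value a \<longleftrightarrow>
    (\<forall>x. 0 \<le> a x) \<and> (\<forall>x. a x = 0 \<longleftrightarrow> x = 0) \<and>
    (\<forall>x y. a (x * y) = a x * a y) \<and> (\<forall>x y. a (x + y) \<le> a x + a y)"

definition induced_by :: "('k::field \<Rightarrow> real) \<Rightarrow> ('k \<Rightarrow> real) \<Rightarrow> bool"
  where "induced_by \<phi> a \<longleftrightarrow>
    \<phi> \<in> ring_hom ring_of_type_algebra ring_of_type_algebra \<and> (\<forall>x. a x = \<bar>\<phi> x\<bar>)"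

definition real_archimedean :: "('k::field \<Rightarrow> real) \<Rightarrow> bool"
  where "real_archimedean a \<longleftrightarrow> (\<exists>\<phi>. induced_by \<phi> a)"

text \<open>Normalized discrete valuations; the value at \<open>0\<close>, conventionally \<open>\<infinity>\<close>, is left unspecified.\<close>

definition discrete_valuation :: "('k::field \<Rightarrow> int) \<Rightarrow> bool"
  where "discrete_valuation v \<longleftrightarrow>
    (\<forall>x y. x \<noteq> 0 \<longrightarrow> y \<noteq> 0 \<longrightarrow> v (x * y) = v x + v y) \<and>
    (\<forall>x y. x \<noteq> 0 \<longrightarrow> y \<noteq> 0 \<longrightarrow> x + y \<noteq> 0 \<longrightarrow> min (v x) (v y) \<le> v (x + y)) \<and>
    v ` (UNIV - {0}) = UNIV"

definition ultrametric_discrete :: "('k::field \<Rightarrow> real) \<Rightarrow> bool"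
  where "ultrametric_discrete a \<longleftrightarrow>
    (\<exists>v c. discrete_valuation v \<and> c > 1 \<and>
      (\<forall>x. a x = (if x = 0 then 0 else c powr (- real_of_int (v x)))))"


section \<open>Henselizations\<close>

definition ultrametric_on :: "'a::field set \<Rightarrow> ('a \<Rightarrow> real) \<Rightarrow> bool"
  where "ultrametric_on L u \<longleftrightarrow>
    (\<forall>x\<in>L. 0 \<le> u x \<and> (u x = 0 \<longleftrightarrow> x = 0)) \<and>
    (\<forall>x\<in>L. \<forall>y\<in>L. u (x * y) = u x * u y \<and> u (x + y) \<le> max (u x) (u y))"

definition valuation_ring :: "'a::field set \<Rightarrow> ('a \<Rightarrow> real) \<Rightarrow> 'a set"
  where "valuation_ring L u = {x\<in>L. u x \<le> 1}"

definition henselian :: "'a::field set \<Rightarrow> ('a \<Rightarrow> real) \<Rightarrow> bool"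
  where "henselian L u \<longleftrightarrow>
    (\<forall>f \<in> polys_over (valuation_ring L u). \<forall>b \<in> valuation_ring L u.
      u (poly f b) < 1 \<and> u (poly (pderiv f) b) = 1 \<longrightarrow>
      (\<exists>c \<in> valuation_ring L u. poly f c = 0 \<and> u (c - b) < 1))"

definition henselian_extension ::
    "('k::field \<Rightarrow> real) \<Rightarrow> 'k alg_closure set \<Rightarrow> ('k alg_closure \<Rightarrow> real) \<Rightarrow> bool"
  where "henselian_extension a L u \<longleftrightarrow>
    intermediate_field L \<and> ultrametric_on L u \<and> (\<forall>x. u (to_ac x) = a x) \<and> henselian L u"

definition valued_embeddings ::
    "'k::field alg_closure set \<Rightarrow> ('k alg_closure \<Rightarrow> real) \<Rightarrow>
     'k alg_closure set \<Rightarrow> ('k alg_closure \<Rightarrow> real) \<Rightarrow> ('k alg_closure \<Rightarrow> 'k alg_closure) set"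
  where "valued_embeddings H w L u =
    {\<sigma> \<in> ring_hom (ring_on H) (ring_on L). (\<forall>x. \<sigma> (to_ac x) = to_ac x) \<and> (\<forall>x\<in>H. u (\<sigma> x) = w x)}"

text \<open>
  The universal property of the Henselization. It is enough to test it on extensions inside the
  algebraic closure: in a Henselian extension of \<open>K\<close>, the elements algebraic over \<open>K\<close> form a
  Henselian field that contains the image of every algebraic extension of \<open>K\<close>.
  The absolute value \<open>w\<close> of \<open>H\<close> is part of the data.
\<close>

definition henselization ::
    "('k::field \<Rightarrow> real) \<Rightarrow> 'k alg_closure set \<Rightarrow> ('k alg_closure \<Rightarrow> real) \<Rightarrow> bool"
  where "henselization a H w \<longleftrightarrow>
    henselian_extension a H w \<and>
    (\<forall>L u. henselian_extension a L u \<longrightarrow>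
      (\<exists>\<sigma>. \<sigma> \<in> valued_embeddings H w L u) \<and>
      (\<forall>\<sigma> \<in> valued_embeddings H w L u. \<forall>\<tau> \<in> valued_embeddings H w L u. \<forall>x\<in>H. \<sigma> x = \<tau> x))"


section \<open>Real closures\<close>

text \<open>The ordering of \<open>K\<close> induced by \<open>a\<close>, given by its set of nonnegative elements. It does not
  depend on \<open>\<phi>\<close>: if \<open>a x = \<bar>\<phi> x\<bar>\<close> for all \<open>x\<close>, then \<open>0 \<le> \<phi> x\<close> iff \<open>a (1 + x) = 1 + a x\<close>.\<close>

definition induced_nonneg :: "('k::field \<Rightarrow> real) \<Rightarrow> 'k set"
  where "induced_nonneg a = {x. \<exists>\<phi>. induced_by \<phi> a \<and> 0 \<le> \<phi> x}"

definition positive_cone :: "'a::field set \<Rightarrow> 'a set \<Rightarrow> bool"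
  where "positive_cone F P \<longleftrightarrow>
    P \<subseteq> F \<and> (\<forall>x\<in>P. \<forall>y\<in>P. x + y \<in> P \<and> x * y \<in> P) \<and>
    (\<forall>x\<in>F. x \<in> P \<or> - x \<in> P) \<and> (\<forall>x\<in>P. - x \<in> P \<longrightarrow> x = 0)"

definition formally_real :: "'a::field set \<Rightarrow> bool"
  where "formally_real F \<longleftrightarrow> \<not> (\<exists>xs. set xs \<subseteq> F \<and> (\<Sum>x\<leftarrow>xs. x ^ 2) = -1)"

text \<open>As \<open>R\<close> contains \<open>K\<close>, every algebraic extension of \<open>R\<close> embeds over \<open>R\<close> into the closure of \<open>K\<close>,
  so proper algebraic extensions may be taken there.\<close>

definition real_closed :: "'k::field alg_closure set \<Rightarrow> bool"
  where "real_closed R \<longleftrightarrow>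
    intermediate_field R \<and> formally_real R \<and>
    (\<forall>L. intermediate_field L \<and> R \<subset> L \<longrightarrow> \<not> formally_real L)"

definition real_closure :: "('k::field \<Rightarrow> real) \<Rightarrow> 'k alg_closure set \<Rightarrow> bool"
  where "real_closure a R \<longleftrightarrow>
    real_closed R \<and> (\<exists>P. positive_cone R P \<and> (\<forall>x. to_ac x \<in> P \<longleftrightarrow> x \<in> induced_nonneg a))"


section \<open>Totally split extensions\<close>

definition local_closures :: "('k::field \<Rightarrow> real) \<Rightarrow> 'k alg_closure set set"
  where "local_closures a =
    {H. ultrametric_discrete a \<and> (\<exists>w. henselization a H w)} \<union>
    {R. real_archimedean a \<and> real_closure a R}"

definition totally_splits :: "('k::field \<Rightarrow> real) \<Rightarrow> 'k alg_closure set \<Rightarrow> bool"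
  where "totally_splits a L \<longleftrightarrow> (\<forall>M \<in> local_closures a. L \<subseteq> M)"

text \<open>For \<open>S = {}\<close> the intersection is the whole algebraic closure.\<close>

definition K_tot :: "('k::field \<Rightarrow> real) set \<Rightarrow> 'k alg_closure set"
  where "K_tot S = (\<Inter>a\<in>S. \<Inter>(local_closures a))"

lemma local_closures_intermediate: "M \<in> local_closures a \<Longrightarrow> intermediate_field M"
  by (auto simp: local_closures_def henselization_def henselian_extension_def
        real_closure_def real_closed_def)

lemma subfield_type_iff:
  fixes L :: "'a::field set"
  shows "subfield L ring_of_type_algebra \<longleftrightarrow>
     1 \<in> L \<and> (\<forall>x\<in>L. \<forall>y\<in>L. x - y \<in> L \<and> x * y \<in> L) \<and> (\<forall>x\<in>L. inverse x \<in> L)"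
    (is "_ \<longleftrightarrow> ?closed")
proof -
  define R :: "'a ring" where "R = ring_of_type_algebra"
  interpret R: field R
    unfolding R_def by (rule field_from_type_algebra)
  have [simp]: "carrier R = UNIV" "\<one>\<^bsub>R\<^esub> = 1" "\<zero>\<^bsub>R\<^esub> = 0" "x \<otimes>\<^bsub>R\<^esub> y = x * y"
      "x \<oplus>\<^bsub>R\<^esub> y = x + y" for x y
    by (simp_all add: R_def ring_of_type_algebra_def)
  have minus [simp]: "\<ominus>\<^bsub>R\<^esub> x = - x" for x
    by (rule sym, rule R.sum_zero_eq_neg) simp_all
  have inv: "inv\<^bsub>R\<^esub> x = inverse x" if "x \<noteq> 0" for x
    by (rule R.inv_unique'[symmetric]) (use that in simp_all)
  have "subfield L R \<longleftrightarrow> ?closed"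
  proof
    assume L: "subfield L R"
    note sub = subringE[OF subfieldE(1)[OF L], simplified]
    have "x - y \<in> L" if "x \<in> L" "y \<in> L" for x y
      using sub(7)[OF that(1) sub(5)[OF that(2)]] by simp
    moreover have "inverse x \<in> L" if "x \<in> L" for x
    proof (cases "x = 0")
      case False
      thus ?thesis
        using R.subfield_m_inv(1)[OF L, of x] that by (simp add: inv)
    qed (use that in simp)
    ultimately show ?closed
      using sub(3,6) by blast
  next
    assume L: ?closed
    have diff: "x - y \<in> L" if "x \<in> L" "y \<in> L" for x y
      using L that by blast
    have zero: "0 \<in> L"
      using diff[of 1 1] L by simp
    have uminus: "- x \<in> L" if "x \<in> L" for x
      using diff[OF zero that] by simp
    have add: "x + y \<in> L" if "x \<in> L" "y \<in> L" for x y
      using diff[OF that(1) uminus[OF that(2)]] by simp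
    have "subring L R"
      by (rule R.subringI) (use L uminus add in simp_all)
    thus "subfield L R"
      by (rule R.subfieldI') (use L in \<open>simp add: inv\<close>)
  qed
  thus ?thesis
    by (simp add: R_def)
qed

lemma intermediate_field_K_tot: "intermediate_field (K_tot S)"
proof -
  have "\<forall>M \<in> (\<Union>a\<in>S. local_closures a). intermediate_field M"
    using local_closures_intermediate by blast
  thus ?thesis
    unfolding K_tot_def intermediate_field_def subfield_type_iff
    by (simp add: subset_iff)
qed

lemma K_tot_maximal:
  "intermediate_field L \<and> (\<forall>a\<in>S. totally_splits a L) \<longleftrightarrow> intermediate_field L \<and> L \<subseteq> K_tot S"
  by (auto simp: totally_splits_def K_tot_def)


section \<open>Hilbertian fields\<close>

text \<open>Elements of \<open>F[Y,X]\<close> are polynomials in \<open>X\<close> whose coefficients are polynomials in \<open>Y\<close>,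
  i.e. members of \<open>polys_over (polys_over F)\<close>.\<close>

definition specialize :: "'a::comm_ring_1 poly poly \<Rightarrow> 'a \<Rightarrow> 'a poly"
  where "specialize f y = map_poly (\<lambda>c. poly c y) f"

text \<open>Coprimality over the rational functions in \<open>Y\<close> does not change under extension of the field of
  constants. The degree condition excludes constants in \<open>X\<close>, which are coprime to their derivative
  \<open>0\<close> but have no irreducible specialization.\<close>

definition separable_in_X :: "'a::field poly poly \<Rightarrow> bool"
  where "separable_in_X f \<longleftrightarrow> Polynomial.degree f > 0 \<and> coprime (fract_poly f) (pderiv (fract_poly f))"

definition hilbertian :: "'a::field set \<Rightarrow> bool"
  where "hilbertian F \<longleftrightarrow>
    (\<forall>f \<in> polys_over (polys_over F).
      ring_irreducible\<^bsub>ring_on (polys_over (polys_over F))\<^esub> f \<and> separable_in_X f \<longrightarrow>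
      (\<exists>y\<in>F. ring_irreducible\<^bsub>ring_on (polys_over F)\<^esub> (specialize f y)))"

end

theory Submission
  imports Defs
begin

text \<open>
  By weak approximation there is \<open>\<pi> \<in> K\<close> that is a uniformizer for every ultrametric element of \<open>S\<close>
  and positive for every real one. Put \<open>B = 1 + \<pi> Y\<^sup>2\<close> and \<open>f = X\<^sup>2 + B X - \<pi> B\<close>; comparing degrees in
  \<open>Y\<close> shows that \<open>f\<close> is absolutely irreducible. For \<open>y\<close> in a Henselization, \<open>\<pi> y\<^sup>2\<close> has odd value, so
  \<open>\<pi> / B(y)\<close> lies in the maximal ideal and Hensel's lemma gives a root of \<open>X\<^sup>2 + X - \<pi> / B(y)\<close>. For
  \<open>y\<close> in a real closure, the discriminant \<open>B(y)\<^sup>2 + 4 \<pi> B(y)\<close> is positive. Hence both roots of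
  \<open>f(y, X)\<close> lie in \<open>K\<^bsub>tot,S\<^esub>\<close> for every \<open>y\<close> in this field.

  That a Henselization \<open>H\<close> has the same value group as \<open>K\<close> follows from the universal property: the
  topological closure of \<open>K\<close> in \<open>H\<close> is Henselian, so \<open>H\<close> embeds into it, and nonzero limits of
  elements of \<open>K\<close> have values in the value group of \<open>K\<close>.
\<close>

section \<open>Weak approximation\<close>

context
  fixes a :: "'k::field \<Rightarrow> real"
  assumes av: "absolute_value a"
begin

lemma av_nonneg: "0 \<le> a x"
  and av_eq_0_iff: "a x = 0 \<longleftrightarrow> x = 0"
  and av_mult: "a (x * y) = a x * a y"
  and av_add_le: "a (x + y) \<le> a x + a y"
  using av by (auto simp: absolute_value_def)

lemma av_pos_iff: "0 < a x \<longleftrightarrow> x \<noteq> 0"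
  using av_nonneg[of x] av_eq_0_iff[of x] by linarith

lemma av_zero: "a 0 = 0"
  by (simp add: av_eq_0_iff)

lemma av_one: "a 1 = 1"
  using av_mult[of 1 1] av_eq_0_iff[of 1] by simp

lemma av_minus: "a (- x) = a x"
proof -
  have "(a (- 1))\<^sup>2 = 1"
    using av_mult[of "-1" "-1"] av_one by (simp add: power2_eq_square)
  then have "a (- 1) = 1"
    using av_nonneg[of "-1"] by (simp add: power2_eq_1_iff)
  then show ?thesis
    using av_mult[of "-1" x] by simp
qed

lemma av_diff_le: "a (x - y) \<le> a x + a y"
  using av_add_le[of x "- y"] av_minus[of y] by simp

lemma av_power: "a (x ^ n) = a x ^ n"
  by (induction n) (simp_all add: av_one av_mult)

lemma av_inverse: "a (inverse x) = inverse (a x)"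
proof (cases "x = 0")
  case False
  then have "a x * a (inverse x) = 1"
    using av_mult[of x "inverse x"] av_one by simp
  then show ?thesis
    by (metis inverse_unique)
qed (simp add: av_zero)

lemma av_divide: "a (x / y) = a x / a y"
  by (simp add: divide_inverse av_mult av_inverse)

lemma av_sum_le: "a (sum f A) \<le> (\<Sum>i\<in>A. a (f i))"
proof (induction A rule: infinite_finite_induct)
  case (insert i A)
  then show ?case
    using av_add_le[of "f i" "sum f A"] by simp
qed (simp_all add: av_zero)

text \<open>The triangle inequality bounds \<open>a (1 + z ^ n)\<close> from below by
  \<open>1 - a z ^ n\<close>, which tends to 1 while the numerator tends to 0.\<close>

lemma av_power_quotient_tendsto_0:
  assumes "a z < 1"
  shows "(\<lambda>n. a (z ^ n / (1 + z ^ n))) \<longlonglongrightarrow> 0"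
proof (rule tendsto_sandwich[of "\<lambda>_. 0" _ _ "\<lambda>n. a z ^ n / (1 - a z ^ n)"])
  have pow: "(\<lambda>n. a z ^ n) \<longlonglongrightarrow> 0"
    using av_nonneg assms by (rule LIMSEQ_realpow_zero)
  from tendsto_divide[OF pow tendsto_diff[OF tendsto_const[of 1] pow]]
  show "(\<lambda>n. a z ^ n / (1 - a z ^ n)) \<longlonglongrightarrow> 0"
    by simp
  have "eventually (\<lambda>n. a z ^ n < 1) sequentially"
    using pow by (rule order_tendstoD) simp
  then show "eventually (\<lambda>n. a (z ^ n / (1 + z ^ n)) \<le> a z ^ n / (1 - a z ^ n)) sequentially"
  proof eventually_elim
    case (elim n)
    have "1 \<le> a (1 + z ^ n) + a z ^ n"
      using av_diff_le[of "1 + z ^ n" "z ^ n"] by (simp add: av_one av_power)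
    then show ?case
      unfolding av_divide av_power using elim av_nonneg[of z]
      by (intro divide_left_mono) (auto intro!: mult_pos_pos)
  qed
qed (use av_nonneg in auto)

text \<open>Reduces to the previous limit for \<open>inverse z\<close>: up to sign, the difference
  is the same quotient formed with \<open>inverse z\<close>.\<close>

lemma av_power_quotient_tendsto_1:
  assumes "1 < a z"
  shows "(\<lambda>n. a (z ^ n / (1 + z ^ n) - 1)) \<longlonglongrightarrow> 0"
proof -
  have z: "z \<noteq> 0"
    using assms av_eq_0_iff[of z] by auto
  have "a (inverse z) < 1"
    using assms by (simp add: av_inverse inverse_less_1_iff)
  then have "(\<lambda>n. a (inverse z ^ n / (1 + inverse z ^ n))) \<longlonglongrightarrow> 0"
    by (rule av_power_quotient_tendsto_0)
  moreover have "eventually (\<lambda>n. a (inverse z ^ n / (1 + inverse z ^ n))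
      = a (z ^ n / (1 + z ^ n) - 1)) sequentially"
    using eventually_gt_at_top[of 0]
  proof eventually_elim
    case (elim n)
    \<comment> \<open>Only positive exponents are considered: for \<open>n = 0\<close> the sum is 2,
      which vanishes in characteristic 2.\<close>
    have ne: "1 + z ^ n \<noteq> 0"
    proof
      assume "1 + z ^ n = 0"
      then have "z ^ n = - 1"
        by (simp add: eq_neg_iff_add_eq_0 add.commute)
      then have "a z ^ n = 1"
        using av_power[of z n] by (simp add: av_minus av_one)
      then show False
        using assms elim one_less_power[of "a z" n] by simp
    qed
    have "inverse z ^ n / (1 + inverse z ^ n) = inverse (1 + z ^ n)"
    proof -
      have "1 + inverse z ^ n = (1 + z ^ n) * inverse (z ^ n)"
        using z by (simp add: field_simps power_inverse)
      then show ?thesis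
        using z ne by (simp add: field_simps)
    qed
    moreover have "z ^ n / (1 + z ^ n) - 1 = - inverse (1 + z ^ n)"
      using ne by (simp add: field_simps)
    ultimately show ?case
      by (simp only: av_minus)
  qed
  ultimately show ?thesis
    by (rule Lim_transform_eventually)
qed

end

section \<open>Equivalence and separation of absolute values\<close>

definition nontrivial_av :: "('k::field \<Rightarrow> real) \<Rightarrow> bool"
  where "nontrivial_av a \<longleftrightarrow> absolute_value a \<and> (\<exists>t. t \<noteq> 0 \<and> a t < 1)"

text \<open>Equivalence is encoded by the open unit balls; for nontrivial absolute values this
  amounts to inducing the same topology.\<close>

definition equivalent_av :: "('k::field \<Rightarrow> real) \<Rightarrow> ('k \<Rightarrow> real) \<Rightarrow> bool"
  where "equivalent_av a b \<longleftrightarrow> (\<forall>x. a x < 1 \<longleftrightarrow> b x < 1)"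

lemma equivalent_av_sym: "equivalent_av a b \<Longrightarrow> equivalent_av b a"
  and equivalent_av_trans: "equivalent_av a b \<Longrightarrow> equivalent_av b c \<Longrightarrow> equivalent_av a c"
  by (simp_all add: equivalent_av_def)

lemma nontrivial_avD: "nontrivial_av a \<Longrightarrow> absolute_value a"
  by (simp add: nontrivial_av_def)

text \<open>Suppose \<open>b x < 1\<close> and \<open>a x \<ge> 1\<close>. If
  \<open>a x = 1\<close>, all \<open>t / x ^ n\<close> stay in the ball of \<open>a\<close>, which
  forces \<open>b t \<le> b x ^ n\<close> for every \<open>n\<close> and hence \<open>t = 0\<close>.
  If \<open>a x > 1\<close>, the inverse of \<open>x\<close> violates the inclusion.\<close>

lemma equivalent_avI:
  assumes a: "nontrivial_av a" and b: "absolute_value b"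
    and le: "\<And>x. a x < 1 \<Longrightarrow> b x < 1"
  shows "equivalent_av a b"
proof -
  note av = nontrivial_avD[OF a]
  obtain t where t: "t \<noteq> 0" "a t < 1"
    using a by (auto simp: nontrivial_av_def)
  have "a x < 1" if x: "b x < 1" for x
  proof (rule ccontr)
    assume "\<not> a x < 1"
    then consider "a x = 1" | "a x > 1"
      by linarith
    then show False
    proof cases
      case 1
      have "b t \<le> b x ^ n" for n
      proof (cases "x = 0")
        case False
        have "a (t / x ^ n) < 1"
          using 1 t by (simp add: av_divide[OF av] av_power[OF av])
        from le[OF this] show ?thesis
          using False av_pos_iff[OF b, of x]
          by (simp add: av_divide[OF b] av_power[OF b] divide_less_eq)
      qed (use 1 av_eq_0_iff[OF av, of x] in auto)
      moreover have "(\<lambda>n. b x ^ n) \<longlonglongrightarrow> 0"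
        using av_nonneg[OF b] x by (rule LIMSEQ_realpow_zero)
      ultimately have "b t \<le> 0"
        by (intro LIMSEQ_le_const) auto
      then show False
        using t av_pos_iff[OF b, of t] by simp
    next
      case 2
      then have "a (inverse x) < 1"
        by (simp add: av_inverse[OF av] inverse_less_1_iff)
      from le[OF this] show False
        using x av_nonneg[OF b, of x] 2 av_eq_0_iff[OF av, of x] av_eq_0_iff[OF b, of x]
        by (auto simp: av_inverse[OF b] inverse_less_1_iff)
    qed
  qed
  then show ?thesis
    using le by (auto simp: equivalent_av_def)
qed

text \<open>By \<open>equivalent_avI\<close> neither unit ball contains the other; a quotient of the
  two witnesses separates.\<close>

lemma separate_two:
  assumes a: "nontrivial_av a" and b: "nontrivial_av b" and ne: "\<not> equivalent_av a b"
  obtains z where "a z > 1" "b z < 1"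
proof -
  note av = nontrivial_avD[OF a] and bv = nontrivial_avD[OF b]
  obtain x where x: "a x < 1" "b x \<ge> 1"
    using equivalent_avI[OF a bv] ne by (meson not_le)
  obtain y where y: "b y < 1" "a y \<ge> 1"
    using equivalent_avI[OF b av] ne equivalent_av_sym by (meson not_le)
  show thesis
  proof (cases "x = 0")
    case False
    then have "a x > 0"
      by (simp add: av_pos_iff[OF av])
    show thesis
      by (rule that[of "y / x"])
        (use x y \<open>a x > 0\<close> in \<open>simp_all add: av_divide[OF av] av_divide[OF bv] less_divide_eq divide_less_eq\<close>)
  qed (use x av_eq_0_iff[OF bv, of x] in auto)
qed

text \<open>The classical induction of Artin and Whaples: an element \<open>z\<close> that works for
  \<open>T\<close> is corrected by an element \<open>y\<close> separating \<open>a\<close> from the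
  new \<open>b\<close>.\<close>

lemma separate_many:
  assumes "finite T" and a: "nontrivial_av a"
    and "\<And>b. b \<in> T \<Longrightarrow> nontrivial_av b \<and> \<not> equivalent_av a b"
  shows "\<exists>z. a z > 1 \<and> (\<forall>b\<in>T. b z < 1)"
  using assms(1,3)
proof (induction T rule: finite_induct)
  case empty
  obtain t where t: "t \<noteq> 0" "a t < 1"
    using a by (auto simp: nontrivial_av_def)
  then have "a (inverse t) > 1"
    using av_pos_iff[OF nontrivial_avD[OF a], of t]
    by (simp add: av_inverse[OF nontrivial_avD[OF a]] one_less_inverse_iff)
  then show ?case
    by blast
next
  case (insert b T)
  note av = nontrivial_avD[OF a]
  have bv: "absolute_value b" and Tv: "\<And>c. c \<in> T \<Longrightarrow> absolute_value c"
    using insert.prems nontrivial_avD by auto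
  obtain z where z: "a z > 1" "\<And>c. c \<in> T \<Longrightarrow> c z < 1"
    using insert by auto
  obtain y where y: "a y > 1" "b y < 1"
    using separate_two[OF a] insert.prems by blast
  show ?case
  proof (cases "b z \<le> 1")
    case True
    \<comment> \<open>High powers of \<open>z\<close> make the product small on \<open>T\<close>,
      while \<open>b z \<le> 1\<close> preserves \<open>b y < 1\<close>.\<close>
    have "eventually (\<lambda>n. c (z ^ n * y) < 1) sequentially" if "c \<in> T" for c
    proof -
      have "(\<lambda>n. c z ^ n) \<longlonglongrightarrow> 0"
        using av_nonneg[OF Tv] z(2) that by (intro LIMSEQ_realpow_zero) auto
      then have "(\<lambda>n. c z ^ n * c y) \<longlonglongrightarrow> 0 * c y"
        by (rule tendsto_mult[OF _ tendsto_const])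
      then have "eventually (\<lambda>n. c z ^ n * c y < 1) sequentially"
        by (rule order_tendstoD) simp
      then show ?thesis
        by (simp add: av_mult av_power Tv that)
    qed
    then have "eventually (\<lambda>n. \<forall>c\<in>T. c (z ^ n * y) < 1) sequentially"
      using insert.hyps by (simp add: eventually_ball_finite)
    then obtain n where n: "\<forall>c\<in>T. c (z ^ n * y) < 1"
      by (auto simp: eventually_sequentially)
    have "a (z ^ n * y) > 1"
    proof -
      have "1 < 1 * a y"
        using y by simp
      also have "1 * a y \<le> a z ^ n * a y"
        using z(1) y(1) by (intro mult_right_mono one_le_power) auto
      finally show ?thesis
        by (simp add: av_mult[OF av] av_power[OF av])
    qed
    moreover have "b (z ^ n * y) < 1"
      using le_less_trans[OF _ y(2)] mult_right_mono[of "b z ^ n" 1 "b y"] True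
        av_nonneg[OF bv]
      by (simp add: av_mult[OF bv] av_power[OF bv] power_le_one)
    ultimately show ?thesis
      using n by auto
  next
    case False
    \<comment> \<open>Powers of \<open>z\<close> alone would grow at \<open>b\<close>. The damped
      factor tends to 1 at both \<open>a\<close> and \<open>b\<close>, leaving the values of
      \<open>y\<close> in the limit, and to 0 on \<open>T\<close>.\<close>
    define x where "x n = z ^ n / (1 + z ^ n) * y" for n
    have one: "(\<lambda>n. c (x n)) \<longlonglongrightarrow> c y" if cv: "absolute_value c" and cz: "c z > 1" for c
    proof -
      have "(\<lambda>n. c (z ^ n / (1 + z ^ n) - 1) * c y) \<longlonglongrightarrow> 0 * c y"
        by (intro tendsto_intros av_power_quotient_tendsto_1 cv cz)
      then have "(\<lambda>n. c (z ^ n / (1 + z ^ n) - 1) * c y) \<longlonglongrightarrow> 0"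
        by simp
      moreover have "norm (c (x n) - c y) \<le> norm (c (z ^ n / (1 + z ^ n) - 1) * c y) * 1" for n
      proof -
        have eq: "c (z ^ n / (1 + z ^ n) - 1) * c y = c (x n - y)"
          by (simp add: x_def av_mult[OF cv, symmetric] algebra_simps)
        show ?thesis
          unfolding eq using av_add_le[OF cv, of "x n - y" y] av_diff_le[OF cv, of "x n" "x n - y"]
          by simp
      qed
      then have "eventually (\<lambda>n. norm (c (x n) - c y)
          \<le> norm (c (z ^ n / (1 + z ^ n) - 1) * c y) * 1) sequentially"
        by (rule always_eventually[OF allI])
      ultimately have "(\<lambda>n. c (x n) - c y) \<longlonglongrightarrow> 0"
        by (rule tendsto_0_le)
      then show ?thesis
        by (simp add: LIM_zero_iff)
    qed
    have zero: "(\<lambda>n. c (x n)) \<longlonglongrightarrow> 0" if "c \<in> T" for c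
    proof -
      have "(\<lambda>n. c (z ^ n / (1 + z ^ n)) * c y) \<longlonglongrightarrow> 0 * c y"
        by (intro tendsto_intros av_power_quotient_tendsto_0 Tv that z)
      then show ?thesis
        by (simp only: x_def av_mult[OF Tv[OF that]] mult_zero_left)
    qed
    have "eventually (\<lambda>n. \<forall>c\<in>T. c (x n) < 1) sequentially"
      using insert.hyps order_tendstoD(2)[OF zero] by (simp add: eventually_ball_finite)
    moreover have "eventually (\<lambda>n. a (x n) > 1) sequentially"
      by (rule order_tendstoD(1)[OF one[OF av z(1)]]) (rule y)
    moreover have "eventually (\<lambda>n. b (x n) < 1) sequentially"
      by (rule order_tendstoD(2)[OF one[OF bv]]) (use False y in auto)
    ultimately have "eventually (\<lambda>n. a (x n) > 1 \<and> (\<forall>c\<in>insert b T. c (x n) < 1)) sequentially"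
      by eventually_elim auto
    then show ?thesis
      by (auto simp: eventually_sequentially)
  qed
qed

lemma weak_approximation:
  assumes T: "finite T" "\<And>a. a \<in> T \<Longrightarrow> nontrivial_av a"
    and ne: "\<And>a b. a \<in> T \<Longrightarrow> b \<in> T \<Longrightarrow> equivalent_av a b \<Longrightarrow> a = b"
    and \<epsilon>: "\<And>a. a \<in> T \<Longrightarrow> \<epsilon> a > (0::real)"
  obtains x where "\<And>a. a \<in> T \<Longrightarrow> a (x - p a) < \<epsilon> a"
proof -
  have "\<exists>z. a z > 1 \<and> (\<forall>b\<in>T - {a}. b z < 1)" if "a \<in> T" for a
    by (rule separate_many) (use that T ne in auto)
  then obtain z where z: "\<And>a. a \<in> T \<Longrightarrow> a (z a) > 1"
    "\<And>a b. a \<in> T \<Longrightarrow> b \<in> T \<Longrightarrow> b \<noteq> a \<Longrightarrow> b (z a) < 1"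
    by (metis DiffI singletonD)
  \<comment> \<open>Approximate idempotents: \<open>e a n\<close> tends to 1 at \<open>a\<close> and
    to 0 at the other members of \<open>T\<close>, so the sum of the \<open>e b n * p b\<close>
    tends to \<open>p a\<close> at each \<open>a\<close>.\<close>
  define e where "e a n = z a ^ n / (1 + z a ^ n)" for a n
  have "eventually (\<lambda>n. a ((\<Sum>b\<in>T. e b n * p b) - p a) < \<epsilon> a) sequentially" if a: "a \<in> T" for a
  proof -
    note av = nontrivial_avD[OF T(2)[OF a]]
    have "(\<lambda>n. a (e b n - of_bool (b = a))) \<longlonglongrightarrow> 0" if "b \<in> T" for b
      using av_power_quotient_tendsto_0[OF av, of "z b"] av_power_quotient_tendsto_1[OF av, of "z b"]
        z a that by (cases "b = a") (auto simp: e_def)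
    then have "(\<lambda>n. \<Sum>b\<in>T. a (e b n - of_bool (b = a)) * a (p b)) \<longlonglongrightarrow> (\<Sum>b\<in>T. 0 * a (p b))"
      by (intro tendsto_intros)
    then have "eventually (\<lambda>n. (\<Sum>b\<in>T. a (e b n - of_bool (b = a)) * a (p b)) < \<epsilon> a) sequentially"
      using \<epsilon>[OF a] by (intro order_tendstoD(2)) auto
    then show ?thesis
    proof eventually_elim
      case (elim n)
      have "(\<Sum>b\<in>T. of_bool (b = a) * p b) = p a"
        using a T(1) by (simp add: sum.remove[of T a])
      then have "(\<Sum>b\<in>T. e b n * p b) - p a = (\<Sum>b\<in>T. (e b n - of_bool (b = a)) * p b)"
        by (simp add: left_diff_distrib sum_subtractf)
      then show ?case
        using av_sum_le[OF av, of "\<lambda>b. (e b n - of_bool (b = a)) * p b" T] elim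
        by (simp add: av_mult[OF av])
    qed
  qed
  then have "eventually (\<lambda>n. \<forall>a\<in>T. a ((\<Sum>b\<in>T. e b n * p b) - p a) < \<epsilon> a) sequentially"
    using T(1) by (simp add: eventually_ball_finite)
  then obtain n where "\<forall>a\<in>T. a ((\<Sum>b\<in>T. e b n * p b) - p a) < \<epsilon> a"
    by (auto simp: eventually_sequentially)
  then show thesis
    using that by blast
qed

section \<open>An element adapted to the absolute values\<close>

lemma induced_by_hom:
  assumes "induced_by \<phi> a"
  shows "\<phi> (x + y) = \<phi> x + \<phi> y" "\<phi> (x * y) = \<phi> x * \<phi> y" "\<phi> 1 = 1" "a x = \<bar>\<phi> x\<bar>"
  using assms by (auto simp: induced_by_def ring_hom_def ring_of_type_algebra_def)

lemma induced_by_hom_of_nat: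
  assumes "induced_by \<phi> a"
  shows "\<phi> (of_nat n) = of_nat n"
proof (induction n)
  case 0
  then show ?case
    using induced_by_hom(1)[OF assms, of 0 0] by simp
qed (simp add: induced_by_hom[OF assms])

lemma real_archimedean_half:
  assumes "real_archimedean a" "absolute_value a"
  shows "a (1 / 2) = 1 / 2"
proof -
  obtain \<phi> where "induced_by \<phi> a"
    using assms(1) by (auto simp: real_archimedean_def)
  then have "a 2 = 2"
    using induced_by_hom_of_nat[of \<phi> a 2] by (simp add: induced_by_hom(4))
  then show ?thesis
    by (simp add: av_divide[OF assms(2)] av_one[OF assms(2)])
qed

text \<open>The ordering can be read off the unit ball: for \<open>n\<close> larger than the
  absolute value of \<open>x\<close>, the quotient \<open>n / (n + x)\<close> lies in the ball
  exactly when \<open>x\<close> is positive.\<close>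

lemma induced_positive_if_equivalent:
  assumes a: "absolute_value a" "induced_by \<phi> a" and b: "absolute_value b" "induced_by \<psi> b"
    and eq: "equivalent_av a b" and pos: "0 < \<phi> x"
  shows "0 < \<psi> x"
proof (rule ccontr)
  assume "\<not> 0 < \<psi> x"
  moreover have "\<psi> x \<noteq> 0"
  proof
    assume "\<psi> x = 0"
    then have "x = 0"
      using av_eq_0_iff[OF b(1), of x] induced_by_hom(4)[OF b(2), of x] by simp
    then show False
      using av_zero[OF a(1)] induced_by_hom(4)[OF a(2), of x] pos by simp
  qed
  ultimately have neg: "\<psi> x < 0"
    by simp
  \<comment> \<open>This bound keeps \<open>n + \<psi> x\<close> strictly between 0 and
    \<open>n\<close>.\<close>
  obtain n where n: "real n > - \<psi> x"
    using reals_Archimedean2 by blast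
  then have n0: "real n > 0"
    using neg by simp
  let ?y = "of_nat n / (of_nat n + x)"
  have "a ?y < 1"
    unfolding av_divide[OF a(1)] using n0 pos
    by (simp add: induced_by_hom[OF a(2)] induced_by_hom_of_nat[OF a(2)])
  then have "b ?y < 1"
    using eq by (simp add: equivalent_av_def)
  moreover have "b ?y > 1"
    unfolding av_divide[OF b(1)] using n0 n neg
    by (simp add: induced_by_hom[OF b(2)] induced_by_hom_of_nat[OF b(2)])
  ultimately show False
    by simp
qed

section \<open>Normalized discrete valuations\<close>

context
  fixes v :: "'k::field \<Rightarrow> int"
  assumes v: "discrete_valuation v"
begin

lemma dv_mult: "x \<noteq> 0 \<Longrightarrow> y \<noteq> 0 \<Longrightarrow> v (x * y) = v x + v y"
  using v by (auto simp: discrete_valuation_def)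

lemma dv_one: "v 1 = 0"
  using dv_mult[of 1 1] by simp

lemma dv_inverse: "x \<noteq> 0 \<Longrightarrow> v (inverse x) = - v x"
  using dv_mult[of x "inverse x"] dv_one by simp

lemma dv_power: "x \<noteq> 0 \<Longrightarrow> v (x ^ n) = int n * v x"
  by (induction n) (simp_all add: dv_one dv_mult algebra_simps)

lemma dv_surj: "\<exists>x. x \<noteq> 0 \<and> v x = n"
  using v unfolding discrete_valuation_def by (metis DiffD1 DiffD2 UNIV_I imageE singletonI)

end

text \<open>Write an element \<open>x\<close> with \<open>w x = 1\<close> as
  \<open>u * \<pi> ^ n\<close> with \<open>v u = 0\<close>. Equal positivity, applied to
  \<open>u\<close> and its inverse, gives \<open>w u = 0\<close>; hence
  \<open>n * w \<pi> = 1\<close> in the integers.\<close>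

lemma discrete_valuation_uniformizer_transfer:
  assumes v: "discrete_valuation v" and w: "discrete_valuation w"
    and iff: "\<And>x. x \<noteq> 0 \<Longrightarrow> 0 < v x \<longleftrightarrow> 0 < w x"
    and \<pi>: "\<pi> \<noteq> 0" "v \<pi> = 1"
  shows "w \<pi> = 1"
proof -
  obtain x where x: "x \<noteq> 0" "w x = 1"
    using dv_surj[OF w] by blast
  then have "0 < v x"
    using iff by simp
  define n where "n = nat (v x)"
  define u where "u = x * inverse (\<pi> ^ n)"
  have u: "u \<noteq> 0"
    using x \<pi> by (simp add: u_def)
  have "v u = 0"
    using x \<pi> \<open>0 < v x\<close> by (simp add: u_def dv_mult[OF v] dv_inverse[OF v] dv_power[OF v] n_def)
  moreover have "w u \<noteq> 0 \<Longrightarrow> v u \<noteq> 0"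
    using iff[OF u] iff[of "inverse u"] u
    by (cases "w u > 0") (auto simp: dv_inverse[OF v] dv_inverse[OF w])
  moreover have "w u = 1 - int n * w \<pi>"
    using x \<pi> by (simp add: u_def dv_mult[OF w] dv_inverse[OF w] dv_power[OF w])
  ultimately have "int n * w \<pi> = 1"
    by linarith
  moreover have "0 < w \<pi>"
    using iff[OF \<pi>(1)] \<pi>(2) by simp
  ultimately show ?thesis
    by (simp add: pos_zmult_eq_1_iff zmult_eq_1_iff)
qed

definition discrete_rep :: "('k::field \<Rightarrow> real) \<Rightarrow> ('k \<Rightarrow> int) \<Rightarrow> real \<Rightarrow> bool"
  where "discrete_rep a v c \<longleftrightarrow> discrete_valuation v \<and> c > 1 \<and>
      (\<forall>x. a x = (if x = 0 then 0 else c powr (- real_of_int (v x))))"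

lemma ultrametric_discrete_iff: "ultrametric_discrete a \<longleftrightarrow> (\<exists>v c. discrete_rep a v c)"
  by (simp add: ultrametric_discrete_def discrete_rep_def)

lemma discrete_rep_less_iff:
  assumes "discrete_rep a v c" "x \<noteq> 0" "y \<noteq> 0"
  shows "a x < a y \<longleftrightarrow> v y < v x"
  using assms by (simp add: discrete_rep_def)

lemma discrete_rep_less_1_iff:
  assumes "discrete_rep a v c" "x \<noteq> 0"
  shows "a x < 1 \<longleftrightarrow> 0 < v x"
  using discrete_rep_less_iff[OF assms, of 1] assms dv_one[of v] by (simp add: discrete_rep_def)

lemma discrete_rep_ultrametric:
  assumes r: "discrete_rep a v c"
  shows "a (x + y) \<le> max (a x) (a y)"
proof (cases "x = 0 \<or> y = 0 \<or> x + y = 0")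
  case False
  then have "min (v x) (v y) \<le> v (x + y)"
    using r by (auto simp: discrete_rep_def discrete_valuation_def)
  then have "\<not> v (x + y) < v x \<or> \<not> v (x + y) < v y"
    by linarith
  then show ?thesis
    using discrete_rep_less_iff[OF r, of x "x + y"] discrete_rep_less_iff[OF r, of y "x + y"] False
    by (auto simp: le_max_iff_disj)
qed (use r in \<open>auto simp: discrete_rep_def le_max_iff_disj\<close>)

text \<open>The element \<open>1 / 2\<close> lies in the unit ball of a real absolute value, whereas
  an ultrametric one satisfies \<open>b 2 \<le> 1\<close>.\<close>

lemma real_not_equivalent_ultrametric:
  fixes a b :: "'a::field \<Rightarrow> real"
  assumes "real_archimedean a" "absolute_value a" "ultrametric_discrete b" "absolute_value b"
  shows "\<not> equivalent_av a b"
proof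
  assume "equivalent_av a b"
  moreover have "a (1 / 2) < 1"
    unfolding real_archimedean_half[OF assms(1,2)] by simp
  ultimately have "b (1 / 2) < 1"
    by (simp only: equivalent_av_def)
  moreover have "(2::'a) \<noteq> 0"
    using real_archimedean_half[OF assms(1,2)] av_zero[OF assms(2)] by auto
  ultimately have "b 2 > 1"
    using av_pos_iff[OF assms(4), of 2] by (simp add: av_divide[OF assms(4)] av_one[OF assms(4)])
  moreover have "b 2 \<le> max (b 1) (b 1)"
    using assms(3) discrete_rep_ultrametric[of b _ _ 1 1] by (auto simp: ultrametric_discrete_iff)
  ultimately show False
    using av_one[OF assms(4)] by simp
qed

text \<open>One predicate for both kinds: a uniformizer in the discrete case, a positive element in
  the real case. Quantifying over all \<open>v\<close>, \<open>c\<close> and \<open>\<phi>\<close>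
  avoids fixing a choice of them.\<close>

definition uniformizes :: "('k::field \<Rightarrow> real) \<Rightarrow> 'k \<Rightarrow> bool"
  where "uniformizes a \<pi> \<longleftrightarrow> (\<forall>v c. discrete_rep a v c \<longrightarrow> v \<pi> = 1) \<and>
     (\<forall>\<phi>. induced_by \<phi> a \<longrightarrow> 0 < \<phi> \<pi>)"

text \<open>Weak approximation handles only one representative of each equivalence class; this
  carries the result to the rest of the class.\<close>

lemma uniformizes_equivalent:
  assumes a: "absolute_value a" "real_archimedean a \<or> ultrametric_discrete a"
    and b: "absolute_value b"
    and eq: "equivalent_av a b" and \<pi>: "\<pi> \<noteq> 0" "uniformizes a \<pi>"
  shows "uniformizes b \<pi>"
  unfolding uniformizes_def
proof (intro conjI allI impI)
  fix w d
  assume w: "discrete_rep b w d"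
  then obtain v c where v: "discrete_rep a v c"
    using a b eq real_not_equivalent_ultrametric[of a b] by (auto simp: ultrametric_discrete_iff)
  have "0 < v x \<longleftrightarrow> 0 < w x" if "x \<noteq> 0" for x
    using eq that discrete_rep_less_1_iff[OF v] discrete_rep_less_1_iff[OF w]
    by (simp add: equivalent_av_def)
  then show "w \<pi> = 1"
    using discrete_valuation_uniformizer_transfer[of v w \<pi>] v w \<pi>
    by (auto simp: discrete_rep_def uniformizes_def)
next
  fix \<psi>
  assume \<psi>: "induced_by \<psi> b"
  then have "\<not> ultrametric_discrete a"
    using real_not_equivalent_ultrametric[of b a] a b eq
    by (auto simp: real_archimedean_def dest: equivalent_av_sym)
  then obtain \<phi> where "induced_by \<phi> a"
    using a(2) by (auto simp: real_archimedean_def)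
  then show "0 < \<psi> \<pi>"
    using induced_positive_if_equivalent[of a \<phi> b \<psi> \<pi>] a b eq \<psi> \<pi> by (auto simp: uniformizes_def)
qed

lemma nontrivial_av_if_real_or_discrete:
  assumes a: "absolute_value a" "real_archimedean a \<or> ultrametric_discrete a"
  shows "nontrivial_av a"
  using a(2)
proof
  assume "real_archimedean a"
  then show ?thesis
    using real_archimedean_half[OF _ a(1)] a(1) av_zero[OF a(1)]
    by (auto simp: nontrivial_av_def intro!: exI[of _ "1 / 2"])
next
  assume "ultrametric_discrete a"
  then obtain v c where v: "discrete_rep a v c"
    by (auto simp: ultrametric_discrete_iff)
  then obtain x where "x \<noteq> 0" "v x = 1"
    using dv_surj[of v 1] by (auto simp: discrete_rep_def)
  then show ?thesis
    using discrete_rep_less_1_iff[OF v, of x] a(1) by (auto simp: nontrivial_av_def)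
qed

text \<open>Provides the ball required by weak approximation: radius \<open>a p\<close> around a
  uniformizer \<open>p\<close>, where the ultrametric inequality gives \<open>a x = a p\<close>, or
  radius 1 around 1 in the real case.\<close>

lemma uniformizes_open:
  assumes a: "absolute_value a" "real_archimedean a \<or> ultrametric_discrete a"
  shows "\<exists>p \<epsilon>. \<epsilon> > 0 \<and> (\<forall>x. a (x - p) < \<epsilon> \<longrightarrow> x \<noteq> 0 \<and> uniformizes a x)"
proof (cases "ultrametric_discrete a")
  case True
  then obtain v c where v: "discrete_rep a v c"
    by (auto simp: ultrametric_discrete_iff)
  then obtain p where p: "p \<noteq> 0" "v p = 1"
    using dv_surj[of v 1] by (auto simp: discrete_rep_def)
  have "x \<noteq> 0 \<and> uniformizes a x" if x: "a (x - p) < a p" for x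
  proof
    show x0: "x \<noteq> 0"
      using x by (auto simp: av_minus[OF a(1)])
    have "a x \<le> max (a (x - p)) (a p)" "a p \<le> max (a (p - x)) (a x)"
      using discrete_rep_ultrametric[OF v, of "x - p" p] discrete_rep_ultrametric[OF v, of "p - x" x]
      by simp_all
    then have eq: "a x = a p"
      using x av_minus[OF a(1), of "x - p"] by simp
    show "uniformizes a x"
      unfolding uniformizes_def
    proof (intro conjI allI impI)
      fix w d
      assume w: "discrete_rep a w d"
      have "v x = v p"
        using discrete_rep_less_iff[OF v x0 p(1)] discrete_rep_less_iff[OF v p(1) x0] eq
        by auto
      \<comment> \<open>Any other representation of \<open>a\<close> has the same unit ball, hence
        the same uniformizers.\<close>
      then show "w x = 1"
        using discrete_valuation_uniformizer_transfer[of v w x] v w p x0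
          discrete_rep_less_1_iff[OF v] discrete_rep_less_1_iff[OF w]
        by (auto simp: discrete_rep_def)
    next
      fix \<phi>
      assume "induced_by \<phi> a"
      then show "0 < \<phi> x"
        using real_not_equivalent_ultrametric[of a a] True a(1)
        by (auto simp: real_archimedean_def equivalent_av_def)
    qed
  qed
  then show ?thesis
    using p av_pos_iff[OF a(1)] by blast
next
  case False
  then have nd: "\<not> discrete_rep a v c" for v c
    by (auto simp: ultrametric_discrete_iff)
  have "x \<noteq> 0 \<and> uniformizes a x" if x: "a (x - 1) < 1" for x
  proof
    show "x \<noteq> 0"
      using x by (auto simp: av_minus[OF a(1)] av_one[OF a(1)])
    have "0 < \<phi> x" if "induced_by \<phi> a" for \<phi>
      using x induced_by_hom(1)[OF that, of "x - 1" 1] by (simp add: induced_by_hom[OF that])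
    then show "uniformizes a x"
      by (auto simp: uniformizes_def nd)
  qed
  then show ?thesis
    by (intro exI[of _ 1]) auto
qed

text \<open>Approximation is carried out on a system of representatives of \<open>S\<close> modulo
  equivalence, and the result is transported back to all of \<open>S\<close>.\<close>

lemma ex_uniformizer:
  fixes S :: "('k::field \<Rightarrow> real) set"
  assumes S: "finite S" "\<And>a. a \<in> S \<Longrightarrow> absolute_value a"
    "\<And>a. a \<in> S \<Longrightarrow> real_archimedean a \<or> ultrametric_discrete a"
  obtains \<pi> where "\<pi> \<noteq> 0" "\<And>a. a \<in> S \<Longrightarrow> uniformizes a \<pi>"
proof (cases "S = {}")
  case True
  then show ?thesis
    using that[of 1] by simp
next
  case False
  \<comment> \<open>The choice depends only on the predicate \<open>equivalent_av a\<close>, so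
    equivalent members receive literally the same representative.\<close>
  define rep where "rep a = (SOME b. b \<in> S \<and> equivalent_av a b)" for a
  have rep: "rep a \<in> S" "equivalent_av a (rep a)" if "a \<in> S" for a
  proof -
    have "rep a \<in> S \<and> equivalent_av a (rep a)"
      unfolding rep_def by (rule someI[of _ a]) (simp add: that equivalent_av_def)
    then show "rep a \<in> S" "equivalent_av a (rep a)"
      by simp_all
  qed
  have rep_eq: "rep a = rep b" if "equivalent_av a b" for a b
  proof -
    have "equivalent_av a c \<longleftrightarrow> equivalent_av b c" for c
      using that equivalent_av_sym equivalent_av_trans by blast
    then show ?thesis
      by (simp only: rep_def)
  qed
  have "\<exists>p \<epsilon>. \<epsilon> > 0 \<and> (\<forall>x. a (x - p) < \<epsilon> \<longrightarrow> x \<noteq> 0 \<and> uniformizes a x)" if "a \<in> S" for a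
    using uniformizes_open[OF S(2,3)] that by simp
  then have "\<exists>p. \<forall>a. a \<in> S \<longrightarrow> (\<exists>\<epsilon>>0. \<forall>x. a (x - p a) < \<epsilon> \<longrightarrow> x \<noteq> 0 \<and> uniformizes a x)"
    by (intro choice) blast
  then obtain p where "\<And>a. a \<in> S \<Longrightarrow> \<exists>\<epsilon>>0. \<forall>x. a (x - p a) < \<epsilon> \<longrightarrow> x \<noteq> 0 \<and> uniformizes a x"
    by auto
  then have "\<exists>\<epsilon>. \<forall>a. a \<in> S \<longrightarrow> \<epsilon> a > 0 \<and> (\<forall>x. a (x - p a) < \<epsilon> a \<longrightarrow> x \<noteq> 0 \<and> uniformizes a x)"
    by (intro choice) blast
  then obtain \<epsilon> where \<epsilon>: "\<And>a. a \<in> S \<Longrightarrow> \<epsilon> a > 0"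
    and p: "\<And>a x. a \<in> S \<Longrightarrow> a (x - p a) < \<epsilon> a \<Longrightarrow> x \<noteq> 0 \<and> uniformizes a x"
    by auto
  have repS: "rep ` S \<subseteq> S"
    using rep(1) by auto
  obtain \<pi> where \<pi>: "\<And>a. a \<in> rep ` S \<Longrightarrow> a (\<pi> - p a) < \<epsilon> a"
  proof (rule weak_approximation[of "rep ` S" \<epsilon> p])
    show "finite (rep ` S)"
      using S(1) by simp
    show "nontrivial_av a" "\<epsilon> a > 0" if "a \<in> rep ` S" for a
      using subsetD[OF repS that] nontrivial_av_if_real_or_discrete[OF S(2,3)] \<epsilon> by simp_all
    show "a = b" if in_rep: "a \<in> rep ` S" "b \<in> rep ` S" and "equivalent_av a b" for a b
    proof -
      obtain a' b' where ab: "a' \<in> S" "a = rep a'" "b' \<in> S" "b = rep b'"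
        using in_rep by auto
      have "equivalent_av a' b'"
        using rep(2)[OF ab(1)] rep(2)[OF ab(3)] \<open>equivalent_av a b\<close> ab by (simp add: equivalent_av_def)
      then show ?thesis
        using rep_eq ab by simp
    qed
  qed (rule that)
  have \<pi>_rep: "\<pi> \<noteq> 0 \<and> uniformizes (rep a) \<pi>" if "a \<in> S" for a
    by (rule p[OF rep(1)[OF that] \<pi>[OF imageI[OF that]]])
  show ?thesis
  proof (rule that[of \<pi>])
    show "\<pi> \<noteq> 0"
      using False \<pi>_rep by auto
    show "uniformizes a \<pi>" if "a \<in> S" for a
      using uniformizes_equivalent[of "rep a" a \<pi>] rep[OF that] S(2,3) that \<pi>_rep[OF that]
      by (simp add: equivalent_av_sym)
  qed
qed

section \<open>A quadratic polynomial without irreducible specializations\<close>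

lemma ring_of_type_algebra_simps:
  "carrier ring_of_type_algebra = UNIV"
  "x \<otimes>\<^bsub>ring_of_type_algebra\<^esub> y = x * y" "x \<oplus>\<^bsub>ring_of_type_algebra\<^esub> y = x + y"
  "\<one>\<^bsub>ring_of_type_algebra\<^esub> = 1" "\<zero>\<^bsub>ring_of_type_algebra\<^esub> = 0"
  by (simp_all add: ring_of_type_algebra_def)

lemma ring_on_Units: "x \<in> Units (ring_on A) \<longleftrightarrow> x \<in> A \<and> (\<exists>u\<in>A. x * u = 1)"
  by (auto simp: Units_def ring_of_type_algebra_simps mult.commute)

text \<open>Replaces proper factors and abstract units by plain factorizations: if
  \<open>f = b * c\<close> and \<open>c\<close> had an inverse in \<open>A\<close>, then
  \<open>f\<close> would divide \<open>b\<close>, so \<open>b\<close> would not be a proper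
  factor.\<close>

lemma ring_irreducible_ring_onI:
  assumes "f \<noteq> 0" "\<And>u. u \<in> A \<Longrightarrow> f * u \<noteq> 1"
    and "\<And>b c. b \<in> A \<Longrightarrow> c \<in> A \<Longrightarrow> f = b * c \<Longrightarrow> (\<exists>u\<in>A. b * u = 1) \<or> (\<exists>u\<in>A. c * u = 1)"
  shows "ring_irreducible\<^bsub>ring_on A\<^esub> f"
  unfolding ring_irreducible_def Divisibility.irreducible_def
proof (intro conjI ballI impI)
  fix b
  assume b: "b \<in> carrier (ring_on A)" and "properfactor (ring_on A) b f"
  then obtain c where c: "c \<in> A" "f = b * c" and nd: "\<And>u. u \<in> A \<Longrightarrow> b \<noteq> f * u"
    by (auto simp: properfactor_def factor_def ring_of_type_algebra_simps)
  have "c * u \<noteq> 1" if "u \<in> A" for u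
    using nd[OF that] c by (metis mult.assoc mult.right_neutral)
  then show "b \<in> Units (ring_on A)"
    using assms(3)[of b c] b c by (auto simp: ring_on_Units ring_of_type_algebra_simps)
qed (use assms(1,2) in \<open>auto simp: ring_of_type_algebra_simps ring_on_Units\<close>)

lemma not_ring_irreducible_ring_on:
  fixes b c :: "'a::idom"
  assumes "b \<in> A" "c \<in> A" "b \<noteq> 0"
    and "\<And>u. u \<in> A \<Longrightarrow> b * u \<noteq> 1" "\<And>u. u \<in> A \<Longrightarrow> c * u \<noteq> 1"
  shows "\<not> ring_irreducible\<^bsub>ring_on A\<^esub> (b * c)"
proof
  assume irr: "ring_irreducible\<^bsub>ring_on A\<^esub> (b * c)"
  have "b \<noteq> b * c * u" if "u \<in> A" for u
    using assms(3) assms(5)[OF that] by (simp add: mult.assoc)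
  then have "properfactor (ring_on A) b (b * c)"
    using assms(2) by (auto simp: properfactor_def factor_def ring_of_type_algebra_simps)
  then have "b \<in> Units (ring_on A)"
    using irr assms(1) by (auto simp: ring_irreducible_def Divisibility.irreducible_def ring_of_type_algebra_simps)
  then show False
    using assms(4) by (auto simp: ring_on_Units)
qed

section \<open>The quadratic polynomial, its irreducibility and separability\<close>

definition split_base :: "'a::comm_ring_1 \<Rightarrow> 'a poly"
  where "split_base p = [:1, 0, p:]"

text \<open>The shape serves both kinds of local closure: the substitution \<open>X = B * Z\<close>
  gives \<open>B ^ 2 * (Z ^ 2 + Z - p / B)\<close>, suited to Hensel's lemma, and the discriminant
  \<open>B ^ 2 + 4 * p * B\<close> is nonnegative when \<open>p\<close> is.\<close>

definition split_poly :: "'a::comm_ring_1 \<Rightarrow> 'a poly poly"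
  where "split_poly p = [:- smult p (split_base p), split_base p, 1:]"

lemma specialize_split_poly:
  "specialize (split_poly p) y = [:- (p * (1 + p * y\<^sup>2)), 1 + p * y\<^sup>2, 1:]"
  by (simp add: specialize_def split_poly_def split_base_def map_poly_pCons power2_eq_square
      algebra_simps)

lemma polys_over_pCons: "0 \<in> A \<Longrightarrow> pCons a q \<in> polys_over A \<longleftrightarrow> a \<in> A \<and> q \<in> polys_over A"
  by (auto simp: polys_over_def coeff_pCons split: nat.splits)

lemma zero_in_polys_over: "0 \<in> A \<Longrightarrow> 0 \<in> polys_over A"
  by (simp add: polys_over_def)

lemma one_in_polys_over: "0 \<in> A \<Longrightarrow> 1 \<in> A \<Longrightarrow> 1 \<in> polys_over A"
  by (simp add: one_pCons polys_over_pCons zero_in_polys_over)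

text \<open>A root satisfies \<open>r * (r + B) = p * B\<close>, so the two factors have degrees in
  \<open>Y\<close> summing to 2; this forces one of them to be constant, which the coefficients then
  exclude.\<close>

lemma split_poly_no_root:
  fixes p :: "'a::field"
  assumes p: "p \<noteq> 0"
  shows "poly (split_poly p) r \<noteq> 0"
proof
  let ?B = "split_base p"
  assume "poly (split_poly p) r = 0"
  then have eq: "r * (r + ?B) = smult p ?B"
    by (simp add: split_poly_def algebra_simps)
  have B: "Polynomial.degree ?B = 2" "?B \<noteq> 0"
    using p by (auto simp: split_base_def)
  then have nz: "r \<noteq> 0" "r + ?B \<noteq> 0"
    using eq p by auto
  then have deg: "Polynomial.degree r + Polynomial.degree (r + ?B) = 2"
    using arg_cong[OF eq, of Polynomial.degree] p B by (simp add: degree_mult_eq)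
  \<comment> \<open>The constant and quadratic coefficients give \<open>e * (e + 1) = p\<close> and
    \<open>e * p = p * p\<close>; hence \<open>e = p\<close> and \<open>p * p = 0\<close>.\<close>
  have const: False if "Polynomial.degree s = 0" "r * (r + ?B) = s * (s + ?B)" for s
  proof -
    define e where "e = Polynomial.coeff s 0"
    have s: "s = [:e:]"
      using degree_0_id[OF that(1)] by (simp add: e_def)
    have "[:e:] * ([:e:] + ?B) = smult p ?B"
      using eq that(2) by (simp add: s)
    then have "e * (e + 1) = p" "e * p = p * p"
      by (simp_all add: split_base_def mult.commute[of e])
    then show False
      using p by (auto simp: algebra_simps)
  qed
  \<comment> \<open>If \<open>r\<close> were linear, \<open>r + B\<close> would still have degree 2,
    for a total of 3.\<close>
  have "Polynomial.degree r \<noteq> 1"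
  proof
    assume r: "Polynomial.degree r = 1"
    then have "Polynomial.degree (r + ?B) = 2"
      using B by (simp add: degree_add_eq_right)
    then show False
      using deg r by simp
  qed
  then consider "Polynomial.degree r = 0" | "Polynomial.degree (r + ?B) = 0"
    using deg by linarith
  then show False
  proof cases
    case 1
    then show False
      using const[of r] by simp
  next
    case 2
    \<comment> \<open>The negative of \<open>r + B\<close> is the other root, so this case reduces
      to a constant root.\<close>
    show False
    proof (rule const)
      show "Polynomial.degree (- (r + ?B)) = 0"
        using 2 by (simp only: degree_minus)
      show "r * (r + ?B) = - (r + ?B) * (- (r + ?B) + ?B)"
        by (simp add: algebra_simps)
    qed
  qed
qed

lemma split_poly_degree: "Polynomial.degree (split_poly (p::'a::field)) = 2"
  by (simp add: split_poly_def)

text \<open>As the polynomial is monic of degree 2 in \<open>X\<close>, a linear factor would give a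
  root, which \<open>split_poly_no_root\<close> excludes over the whole ambient field; a factor
  constant in \<open>X\<close> is a unit.\<close>

lemma split_poly_irreducible:
  fixes p :: "'a::field"
  assumes p: "p \<noteq> 0" and A: "0 \<in> A"
  shows "ring_irreducible\<^bsub>ring_on (polys_over (polys_over A))\<^esub> (split_poly p)"
proof (rule ring_irreducible_ring_onI)
  show f0: "split_poly p \<noteq> 0"
    by (simp add: split_poly_def)
  show "split_poly p * u \<noteq> 1" for u
  proof
    assume u: "split_poly p * u = 1"
    then have "u \<noteq> 0"
      by auto
    then have "Polynomial.degree (split_poly p * u) \<ge> 2"
      using f0 by (simp add: degree_mult_eq split_poly_degree)
    then show False
      by (simp add: u)
  qed
  fix b c
  assume b: "b \<in> polys_over (polys_over A)" and c: "c \<in> polys_over (polys_over A)"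
    and eq: "split_poly p = b * c"
  have deg: "Polynomial.degree b + Polynomial.degree c = 2"
    using f0 eq split_poly_degree[of p] by (auto simp: degree_mult_eq)
  have lc: "Polynomial.lead_coeff b * Polynomial.lead_coeff c = 1"
    using arg_cong[OF eq, of Polynomial.lead_coeff]
    by (simp add: lead_coeff_mult split_poly_def)
  \<comment> \<open>The leading coefficients multiply to 1, so that of the cofactor is the inverse
    and already has its coefficients in \<open>A\<close>.\<close>
  have unit: "\<exists>u\<in>polys_over (polys_over A). d * u = 1"
    if "Polynomial.degree d = 0" "Polynomial.lead_coeff d * Polynomial.lead_coeff e = 1"
      "e \<in> polys_over (polys_over A)" for d e :: "'a poly poly"
  proof
    show "[:Polynomial.lead_coeff e:] \<in> polys_over (polys_over A)"
      using that(3) A by (simp add: polys_over_pCons zero_in_polys_over) (simp add: polys_over_def)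
    show "d * [:Polynomial.lead_coeff e:] = 1"
      using that(1,2) by (auto elim!: degree_eq_zeroE simp: one_pCons mult.commute)
  qed
  have "Polynomial.degree b \<noteq> 1"
  proof
    assume "Polynomial.degree b = 1"
    then obtain b0 b1 where "b = [:b0, b1:]" "b1 \<noteq> 0"
      by (rule degree1_coeffs)
    \<comment> \<open>The leading coefficient of \<open>c\<close> inverts \<open>b1\<close>, so this
      argument is the root \<open>- b0 / b1\<close>.\<close>
    then have "poly b (- (b0 * Polynomial.lead_coeff c)) = b0 - (Polynomial.lead_coeff b * Polynomial.lead_coeff c) * b0"
      by (simp add: mult_ac)
    then have "poly (split_poly p) (- (b0 * Polynomial.lead_coeff c)) = 0"
      by (simp add: eq lc)
    then show False
      using split_poly_no_root[OF p] by blast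
  qed
  then consider "Polynomial.degree b = 0" | "Polynomial.degree c = 0"
    using deg by linarith
  then show "(\<exists>u\<in>polys_over (polys_over A). b * u = 1) \<or> (\<exists>u\<in>polys_over (polys_over A). c * u = 1)"
    by cases (use unit[of b c] unit[of c b] b c lc in \<open>auto simp: mult.commute\<close>)
qed

text \<open>The discriminant \<open>f'\<^sup>2 - 4 f\<close> is a nonzero constant, whatever the characteristic.\<close>

lemma separable_split_poly:
  fixes p :: "'a::field"
  assumes p: "p \<noteq> 0"
  shows "separable_in_X (split_poly p)"
proof -
  let ?B = "split_base p"
  define q where "q = to_fract [:p:]"
  define b where "b = to_fract ?B"
  define F where "F = fract_poly (split_poly p)"
  have F: "F = [:- (q * b), b, 1:]"
  proof -
    have "smult p ?B = [:p:] * ?B"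
      by simp
    then show ?thesis
      unfolding F_def split_poly_def q_def b_def
      by (simp add: map_poly_pCons flip: to_fract_mult del: to_fract_mult)
  qed
  have dF: "pderiv F = [:b, 2:]"
    by (simp add: F pderiv_pCons)
  have id: "smult 4 F - pderiv F * pderiv F = [:- (4 * q * b + b * b):]"
    unfolding dF by (simp add: F algebra_simps)
  \<comment> \<open>Both factors keep the coefficient \<open>p\<close> at degree 2, so the product
    is nonzero in every characteristic.\<close>
  have "?B * (?B + [:4 * p:]) \<noteq> 0"
    using p by (simp add: split_base_def)
  moreover have "to_fract (?B * (?B + [:4 * p:])) = 4 * q * b + b * b"
  proof -
    have "[:4 * p:] = [:p:] + [:p:] + [:p:] + [:p:]"
      by simp
    then have "to_fract [:4 * p:] = 4 * q"
      by (simp only: to_fract_add q_def) simp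
    then show ?thesis
      unfolding to_fract_mult to_fract_add b_def by (simp add: distrib_left mult.commute)
  qed
  ultimately have nz: "4 * q * b + b * b \<noteq> 0"
    by (metis to_fract_eq_0_iff)
  have "coprime F (pderiv F)"
  proof (rule coprimeI)
    fix d
    assume "d dvd F" "d dvd pderiv F"
    then have "d dvd smult 4 F - pderiv F * pderiv F"
      by (intro dvd_diff dvd_smult dvd_mult)
    then have "d dvd [:- (4 * q * b + b * b):]"
      unfolding id .
    also have "[:- (4 * q * b + b * b):] dvd 1"
      using nz by (simp only: is_unit_const_poly_iff dvd_field_iff neg_equal_0_iff_equal) simp
    finally show "is_unit d" .
  qed
  then show ?thesis
    by (simp add: separable_in_X_def F_def split_poly_degree)
qed

lemma quadratic_not_irreducible:
  fixes s t :: "'a::field"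
  assumes A: "0 \<in> A" "1 \<in> A" "- s \<in> A" "- t \<in> A"
  shows "\<not> ring_irreducible\<^bsub>ring_on (polys_over A)\<^esub> [:s * t, - (s + t), 1:]"
proof -
  have nu: "[:- x, 1:] * u \<noteq> 1" for x :: 'a and u
  proof
    assume u: "[:- x, 1:] * u = 1"
    then have "u \<noteq> 0"
      by auto
    then have "Polynomial.degree ([:- x, 1:] * u) \<ge> 1"
      by (subst degree_mult_eq) auto
    then show False
      unfolding u by simp
  qed
  have "\<not> ring_irreducible\<^bsub>ring_on (polys_over A)\<^esub> ([:- s, 1:] * [:- t, 1:])"
    by (rule not_ring_irreducible_ring_on)
      (use nu A in \<open>auto simp: polys_over_pCons zero_in_polys_over\<close>)
  moreover have "[:- s, 1:] * [:- t, 1:] = [:s * t, - (s + t), 1:]"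
    by simp
  ultimately show ?thesis
    by metis
qed

section \<open>The value group of a Henselization\<close>

context
  fixes A :: "'a::field set"
  assumes zero: "0 \<in> A" and one: "1 \<in> A"
    and add: "\<And>x y. x \<in> A \<Longrightarrow> y \<in> A \<Longrightarrow> x + y \<in> A"
    and mult: "\<And>x y. x \<in> A \<Longrightarrow> y \<in> A \<Longrightarrow> x * y \<in> A"
begin

lemma poly_mem: "f \<in> polys_over A \<Longrightarrow> x \<in> A \<Longrightarrow> poly f x \<in> A"
  by (induction f) (auto simp: polys_over_pCons zero add mult)

lemma pderiv_mem: "f \<in> polys_over A \<Longrightarrow> pderiv f \<in> polys_over A"
proof -
  have "of_nat n \<in> A" for n
    by (induction n) (auto simp: zero one add)
  then show "f \<in> polys_over A \<Longrightarrow> pderiv f \<in> polys_over A"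
    by (auto simp: polys_over_def coeff_pderiv mult simp del: of_nat_Suc)
qed

text \<open>Induction along the Horner form keeps the remainder in \<open>A\<close> without any
  division, as needed over a valuation ring.\<close>

lemma poly_taylor_1:
  assumes "f \<in> polys_over A" "x \<in> A" "c \<in> A"
  shows "\<exists>e\<in>A. poly f x = poly f c + (x - c) * e"
  using assms(1)
proof (induction f)
  case 0
  show ?case
    using zero by (intro bexI[of _ 0]) auto
next
  case (pCons a g)
  then have g: "g \<in> polys_over A"
    by (simp add: polys_over_pCons zero)
  with pCons obtain e where e: "e \<in> A" "poly g x = poly g c + (x - c) * e"
    by blast
  have "poly (pCons a g) x = poly (pCons a g) c + (x - c) * (x * e + poly g c)"
    by (simp add: e(2) algebra_simps)
  then show ?case
    using e(1) g assms by (intro bexI[of _ "x * e + poly g c"]) (auto simp: add mult poly_mem)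
qed

lemma poly_taylor_2:
  assumes "f \<in> polys_over A" "x \<in> A" "c \<in> A"
  shows "\<exists>e\<in>A. poly f x = poly f c + (x - c) * poly (pderiv f) c + (x - c)\<^sup>2 * e"
  using assms(1)
proof (induction f)
  case 0
  show ?case
    using zero by (intro bexI[of _ 0]) auto
next
  case (pCons a g)
  then have g: "g \<in> polys_over A"
    by (simp add: polys_over_pCons zero)
  with pCons obtain e where e: "e \<in> A"
    "poly g x = poly g c + (x - c) * poly (pderiv g) c + (x - c)\<^sup>2 * e"
    by blast
  obtain d where d: "d \<in> A" "poly g x = poly g c + (x - c) * d"
    using poly_taylor_1[OF g assms(2,3)] by blast
  \<comment> \<open>For \<open>a + X * g\<close> the second-order error splits into \<open>c\<close>
    times that of \<open>g\<close> and \<open>x - c\<close> times the first-order error of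
    \<open>g\<close>.\<close>
  have "poly (pCons a g) x - poly (pCons a g) c - (x - c) * poly (pderiv (pCons a g)) c
      = c * (poly g x - (poly g c + (x - c) * poly (pderiv g) c)) + (x - c) * (poly g x - poly g c)"
    by (simp add: pderiv_pCons algebra_simps)
  also have "\<dots> = c * ((x - c)\<^sup>2 * e) + (x - c) * ((x - c) * d)"
    using d(2) e(2) by simp
  also have "\<dots> = (x - c)\<^sup>2 * (c * e + d)"
    by (simp add: power2_eq_square algebra_simps)
  finally have "poly (pCons a g) x = poly (pCons a g) c + (x - c) * poly (pderiv (pCons a g)) c
      + (x - c)\<^sup>2 * (c * e + d)"
    by (simp only: diff_eq_eq) (simp add: algebra_simps)
  then show ?case
    using e(1) d(1) assms by (intro bexI[of _ "c * e + d"]) (auto simp: add mult)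
qed

end

section \<open>Ultrametric subfields and topological closures\<close>

locale ultrametric_subfield =
  fixes H :: "'a::field set" and w :: "'a \<Rightarrow> real"
  assumes subfield: "subfield H ring_of_type_algebra" and ultrametric: "ultrametric_on H w"
begin

lemma one_mem: "1 \<in> H"
  and diff_mem: "x \<in> H \<Longrightarrow> y \<in> H \<Longrightarrow> x - y \<in> H"
  and mult_mem: "x \<in> H \<Longrightarrow> y \<in> H \<Longrightarrow> x * y \<in> H"
  and inverse_mem: "x \<in> H \<Longrightarrow> inverse x \<in> H"
  using subfield by (simp_all add: subfield_type_iff)

lemma zero_mem: "0 \<in> H"
  using diff_mem[OF one_mem one_mem] by simp

lemma minus_mem: "x \<in> H \<Longrightarrow> - x \<in> H"
  using diff_mem[OF zero_mem] by simp

lemma add_mem: "x \<in> H \<Longrightarrow> y \<in> H \<Longrightarrow> x + y \<in> H"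
  using diff_mem[OF _ minus_mem, of x y] by simp

lemma w_nonneg: "x \<in> H \<Longrightarrow> 0 \<le> w x"
  and w_eq_0: "x \<in> H \<Longrightarrow> w x = 0 \<longleftrightarrow> x = 0"
  and w_mult: "x \<in> H \<Longrightarrow> y \<in> H \<Longrightarrow> w (x * y) = w x * w y"
  and w_add_le: "x \<in> H \<Longrightarrow> y \<in> H \<Longrightarrow> w (x + y) \<le> max (w x) (w y)"
  using ultrametric by (auto simp: ultrametric_on_def)

lemma w_zero: "w 0 = 0"
  by (simp add: w_eq_0 zero_mem)

lemma w_pos: "x \<in> H \<Longrightarrow> x \<noteq> 0 \<Longrightarrow> 0 < w x"
  using w_nonneg[of x] w_eq_0[of x] by linarith

lemma w_one: "w 1 = 1"
  using w_mult[OF one_mem one_mem] w_eq_0[OF one_mem] by simp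

lemma w_minus: "x \<in> H \<Longrightarrow> w (- x) = w x"
proof -
  have "(w (- 1))\<^sup>2 = 1"
    using w_mult[of "-1" "-1"] w_one one_mem minus_mem by (simp add: power2_eq_square)
  then have "w (- 1) = 1"
    using w_nonneg[of "-1"] one_mem minus_mem by (simp add: power2_eq_1_iff)
  then show "x \<in> H \<Longrightarrow> w (- x) = w x"
    using w_mult[of "-1" x] one_mem minus_mem by simp
qed

lemma w_diff_le: "x \<in> H \<Longrightarrow> y \<in> H \<Longrightarrow> w (x - y) \<le> max (w x) (w y)"
  using w_add_le[of x "- y"] minus_mem[of y] w_minus[of y] by simp

lemma w_inverse: "x \<in> H \<Longrightarrow> w (inverse x) = inverse (w x)"
proof (cases "x = 0")
  case False
  then show "x \<in> H \<Longrightarrow> w (inverse x) = inverse (w x)"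
    using w_mult[of x "inverse x"] inverse_mem w_one by (metis inverse_unique right_inverse)
qed (simp add: w_zero)

text \<open>The isosceles triangle principle of ultrametric spaces.\<close>

lemma w_eq_if_less:
  assumes "x \<in> H" "y \<in> H" "w (x - y) < w x"
  shows "w y = w x"
proof (rule antisym)
  have "w x \<le> max (w (x - y)) (w y)"
    using w_add_le[of "x - y" y] assms diff_mem by simp
  then show "w x \<le> w y"
    using assms by simp
  show "w y \<le> w x"
    using w_diff_le[of x "x - y"] assms diff_mem by simp
qed

lemma valuation_ring_iff: "x \<in> valuation_ring H w \<longleftrightarrow> x \<in> H \<and> w x \<le> 1"
  by (simp add: valuation_ring_def)

lemma valuation_ring_closed:
  shows "0 \<in> valuation_ring H w" "1 \<in> valuation_ring H w"
    and "x \<in> valuation_ring H w \<Longrightarrow> y \<in> valuation_ring H w \<Longrightarrow> x + y \<in> valuation_ring H w"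
    and "x \<in> valuation_ring H w \<Longrightarrow> y \<in> valuation_ring H w \<Longrightarrow> x * y \<in> valuation_ring H w"
    and "x \<in> valuation_ring H w \<Longrightarrow> y \<in> valuation_ring H w \<Longrightarrow> x - y \<in> valuation_ring H w"
  using w_add_le[of x y] w_diff_le[of x y] mult_le_one[of "w x" "w y"] w_zero
  by (auto simp: valuation_ring_iff zero_mem one_mem add_mem mult_mem diff_mem w_one w_mult w_nonneg)

text \<open>The closure is taken inside \<open>H\<close>, not in a completion, so it remains within
  the algebraic closure.\<close>

definition topological_closure :: "'a set \<Rightarrow> 'a set"
  where "topological_closure K = {x \<in> H. \<forall>\<epsilon>>0. \<exists>k\<in>K. w (x - k) < \<epsilon>}"

lemma topological_closure_subset: "topological_closure K \<subseteq> H"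
  by (auto simp: topological_closure_def)

lemma subset_topological_closure: "K \<subseteq> H \<Longrightarrow> K \<subseteq> topological_closure K"
  using w_zero by (auto simp: topological_closure_def intro!: bexI)

lemma topological_closure_idem:
  assumes K: "K \<subseteq> H" and x: "x \<in> H" and lim: "\<And>\<epsilon>. \<epsilon> > 0 \<Longrightarrow> \<exists>y\<in>topological_closure K. w (x - y) < \<epsilon>"
  shows "x \<in> topological_closure K"
proof -
  have "\<exists>k\<in>K. w (x - k) < \<epsilon>" if \<epsilon>: "\<epsilon> > 0" for \<epsilon>
  proof -
    obtain y where y: "y \<in> topological_closure K" "w (x - y) < \<epsilon>"
      using lim[OF \<epsilon>] by blast
    then obtain k where k: "k \<in> K" "w (y - k) < \<epsilon>"
      using \<epsilon> by (auto simp: topological_closure_def)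
    have "y \<in> H" "k \<in> H"
      using y k K topological_closure_subset by auto
    then have "w (x - k) < \<epsilon>"
      using w_add_le[of "x - y" "y - k"] x y k by (simp add: diff_mem)
    then show ?thesis
      using k by blast
  qed
  then show ?thesis
    using x by (simp add: topological_closure_def)
qed

text \<open>An approximation of \<open>x\<close> with error below \<open>w x\<close> already has the
  value of \<open>x\<close>, so the closure acquires no new values.\<close>

lemma value_of_topological_closure:
  assumes "K \<subseteq> H" "x \<in> topological_closure K" "x \<noteq> 0"
  obtains k where "k \<in> K" "w k = w x"
proof -
  have x: "x \<in> H"
    using assms topological_closure_subset by auto
  then have "\<exists>k\<in>K. w (x - k) < w x"
    using assms w_pos by (simp add: topological_closure_def)
  then obtain k where "k \<in> K" "w (x - k) < w x"
    by blast
  then show ?thesis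
    using that[of k] w_eq_if_less[of x k] x assms(1) by blast
qed

lemma subfield_topological_closure:
  assumes sub: "subfield K ring_of_type_algebra" and K: "K \<subseteq> H"
  shows "subfield (topological_closure K) ring_of_type_algebra"
proof -
  let ?L = "topological_closure K"
  interpret K: ultrametric_subfield K w
  proof (rule ultrametric_subfield.intro[OF sub])
    show "ultrametric_on K w"
      using ultrametric K by (simp add: ultrametric_on_def subset_iff)
  qed
  have mem: "x \<in> H" if "x \<in> ?L" for x
    using that topological_closure_subset by auto
  have approx: "\<exists>k\<in>K. w (x - k) < \<epsilon> \<and> k \<in> H" if "x \<in> ?L" "\<epsilon> > 0" for x \<epsilon>
    using that K by (simp add: topological_closure_def) (meson subsetD)
  have "1 \<in> ?L"
    using subset_topological_closure[OF K] K.one_mem by auto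
  moreover have "x - y \<in> ?L" if x: "x \<in> ?L" and y: "y \<in> ?L" for x y
  proof -
    have "\<exists>k\<in>K. w (x - y - k) < \<epsilon>" if \<epsilon>: "\<epsilon> > 0" for \<epsilon>
    proof -
      obtain k l where k: "k \<in> K" "w (x - k) < \<epsilon>" "k \<in> H" and l: "l \<in> K" "w (y - l) < \<epsilon>" "l \<in> H"
        using approx x y \<epsilon> by meson
      have "x - y - (k - l) = (x - k) - (y - l)"
        by simp
      then have "w (x - y - (k - l)) < \<epsilon>"
        using w_diff_le[of "x - k" "y - l"] k l mem x y by (simp only: diff_mem) simp
      then show ?thesis
        using K.diff_mem k l by blast
    qed
    then show ?thesis
      using mem x y by (simp add: topological_closure_def diff_mem)
  qed
  moreover have "x * y \<in> ?L" if x: "x \<in> ?L" and y: "y \<in> ?L" for x y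
  proof -
    have "\<exists>k\<in>K. w (x * y - k) < \<epsilon>" if \<epsilon>: "\<epsilon> > 0" for \<epsilon>
    proof -
      \<comment> \<open>\<open>M\<close> bounds both factors, and also any \<open>l\<close> within
        distance 1 of \<open>y\<close>; with error \<open>\<delta>\<close> in each factor the
        product is off by less than \<open>M * \<delta> \<le> \<epsilon>\<close>.\<close>
      define M where "M = max 1 (max (w x) (w y))"
      define \<delta> where "\<delta> = min 1 (\<epsilon> / M)"
      have M: "M \<ge> 1" "w x \<le> M" "w y \<le> M"
        by (auto simp: M_def)
      have \<delta>: "\<delta> > 0" "\<delta> \<le> 1" "M * \<delta> \<le> \<epsilon>"
        using M \<epsilon> by (auto simp: \<delta>_def min_def field_simps)
      have small: "w (u * z) < \<epsilon>" if "u \<in> H" "z \<in> H" "w u \<le> M" "w z < \<delta>" for u z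
      proof -
        have "w (u * z) \<le> M * w z"
          using that w_nonneg[of z] by (simp add: w_mult mult_right_mono)
        also have "\<dots> < M * \<delta>"
          using M(1) that(4) by (intro mult_strict_left_mono) auto
        finally show ?thesis
          using \<delta>(3) by simp
      qed
      obtain k l where k: "k \<in> K" "w (x - k) < \<delta>" "k \<in> H" and l: "l \<in> K" "w (y - l) < \<delta>" "l \<in> H"
        using approx x y \<delta> by meson
      note xy = mem[OF x] mem[OF y]
      have "w l \<le> M"
        using w_diff_le[of y "y - l"] l xy M \<delta> by (simp add: diff_mem)
      then have "w ((x - k) * l) < \<epsilon>"
        using small[of l "x - k"] k l xy by (simp add: diff_mem mult.commute)
      moreover have "w (x * (y - l)) < \<epsilon>"
        using small[of x "y - l"] l xy M by (simp add: diff_mem)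
      moreover have "x * y - k * l = (x - k) * l + x * (y - l)"
        by (simp add: algebra_simps)
      ultimately have "w (x * y - k * l) < \<epsilon>"
        using w_add_le[of "(x - k) * l" "x * (y - l)"] k l xy
        by (simp only: mult_mem diff_mem) simp
      then show ?thesis
        using K.mult_mem k l by blast
    qed
    then show ?thesis
      using mem x y by (simp add: topological_closure_def mult_mem)
  qed
  moreover have "inverse x \<in> ?L" if x: "x \<in> ?L" for x
  proof (cases "x = 0")
    case False
    note xH = mem[OF x]
    have wx: "w x > 0"
      using False xH by (rule w_pos[rotated])
    have "\<exists>k\<in>K. w (inverse x - k) < \<epsilon>" if \<epsilon>: "\<epsilon> > 0" for \<epsilon>
    proof -
      \<comment> \<open>The first bound forces \<open>w k = w x\<close>; the second compensates for
        the denominator \<open>x * k\<close> of the difference of inverses.\<close>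
      have "min (w x) (\<epsilon> * (w x * w x)) > 0"
        using wx \<epsilon> by simp
      then obtain k where k: "k \<in> K" "w (x - k) < min (w x) (\<epsilon> * (w x * w x))" "k \<in> H"
        using approx[OF x] by blast
      have wk: "w k = w x"
        using w_eq_if_less[of x k] k xH by simp
      then have k0: "k \<noteq> 0"
        using wx w_zero by auto
      have "inverse x - inverse k = - (inverse (x * k) * (x - k))"
        using k0 False by (simp add: field_simps)
      then have "w (inverse x - inverse k) = inverse (w x * w x) * w (x - k)"
        using k xH wk by (simp add: w_minus w_mult w_inverse inverse_mem mult_mem diff_mem)
      also have "\<dots> < \<epsilon>"
        using k(2) wx by (simp add: field_simps)
      finally show ?thesis
        using K.inverse_mem k by blast
    qed
    then show ?thesis
      using mem x by (simp add: topological_closure_def inverse_mem)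
  qed (use subset_topological_closure[OF K] K.zero_mem in auto)
  ultimately show ?thesis
    by (simp add: subfield_type_iff)
qed

text \<open>The Newton iteration with the slope frozen at \<open>b\<close> stays in the closure and converges to the
  root in \<open>H\<close>.\<close>

lemma henselian_topological_closure:
  assumes sub: "subfield K ring_of_type_algebra" and K: "K \<subseteq> H" and hens: "henselian H w"
  shows "henselian (topological_closure K) w"
  unfolding henselian_def
proof (intro ballI impI)
  let ?L = "topological_closure K"
  let ?OL = "valuation_ring ?L w" and ?OH = "valuation_ring H w"
  interpret L: ultrametric_subfield ?L w
  proof (rule ultrametric_subfield.intro[OF subfield_topological_closure[OF sub K]])
    show "ultrametric_on ?L w"
      using ultrametric topological_closure_subset[of K] by (simp add: ultrametric_on_def subset_iff)
  qed
  fix f b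
  assume f: "f \<in> polys_over ?OL" and b: "b \<in> ?OL"
    and fb: "w (poly f b) < 1 \<and> w (poly (pderiv f) b) = 1"
  have LH: "?OL \<subseteq> ?OH"
    using topological_closure_subset by (auto simp: valuation_ring_def)
  then have fH: "f \<in> polys_over ?OH" and bH: "b \<in> ?OH"
    using f b by (auto simp: polys_over_def)
  \<comment> \<open>Henselianity of \<open>H\<close> supplies a root \<open>c\<close>; what remains
    is that \<open>c\<close> lies in the closure.\<close>
  then obtain c where c: "c \<in> ?OH" "poly f c = 0" "w (c - b) < 1"
    using hens fb unfolding henselian_def by blast
  define s where "s = poly (pderiv f) b"
  define \<theta> where "\<theta> = w (c - b)"
  have bc: "b \<in> H" "c \<in> H"
    using bH c by (auto simp: valuation_ring_iff)
  have \<theta>: "0 \<le> \<theta>" "\<theta> < 1" "w (b - c) = \<theta>"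
    using c bc w_nonneg[of "c - b"] w_minus[of "b - c"] by (auto simp: \<theta>_def diff_mem)
  note OL = L.valuation_ring_closed and OH = valuation_ring_closed
  have pd: "pderiv f \<in> polys_over ?OL" "pderiv f \<in> polys_over ?OH"
    by (rule pderiv_mem[OF OL(1-4) f] pderiv_mem[OF OH(1-4) fH]; assumption)+
  have s: "s \<in> ?OL"
    unfolding s_def by (rule poly_mem[OF OL(1-4) pd(1) b])
  have ws: "w s = 1" "s \<noteq> 0"
    using fb w_zero by (auto simp: s_def)
  have inv_s: "inverse s \<in> ?OL"
    using s ws by (simp add: L.valuation_ring_iff L.inverse_mem L.w_inverse)
  \<comment> \<open>The iteration starts at \<open>b\<close>, whose distance to \<open>c\<close> is
    \<open>\<theta>\<close>; hence the exponent \<open>Suc n\<close>.\<close>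
  have step: "\<exists>x\<in>?OL. w (x - c) \<le> \<theta> ^ Suc n" for n
  proof (induction n)
    case 0
    show ?case
      using b \<theta> by auto
  next
    case (Suc n)
    then obtain x where x: "x \<in> ?OL" "w (x - c) \<le> \<theta> ^ Suc n"
      by blast
    have xH: "x \<in> ?OH"
      using x LH by blast
    obtain e where e: "e \<in> ?OH"
      "poly f x = poly f c + (x - c) * poly (pderiv f) c + (x - c)\<^sup>2 * e"
      using poly_taylor_2[OF OH(1-4) fH xH c(1)] by blast
    obtain e' where e': "e' \<in> ?OH" "s = poly (pderiv f) c + (b - c) * e'"
      using poly_taylor_1[OF OH(1-4) pd(2) bH c(1)] by (auto simp: s_def)
    define y where "y = x - poly f x * inverse s"
    \<comment> \<open>Expanding \<open>f\<close> to second order and its derivative to first order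
      at \<open>c\<close> exhibits the error of \<open>s\<close> as a slope; both correction terms
      have size at most \<open>\<theta>\<close>, so each step contracts by
      \<open>\<theta>\<close>.\<close>
    have "poly f x = (x - c) * (s - ((b - c) * e' - (x - c) * e))"
      by (simp add: e(2) e'(2) c(2) power2_eq_square algebra_simps)
    then have "y - c = (x - c) * ((b - c) * e' - (x - c) * e) * inverse s"
      using ws by (simp add: y_def field_simps)
    moreover have "x \<in> H" "e \<in> H" "e' \<in> H" "s \<in> H"
      using xH e e' s LH by (auto simp: valuation_ring_iff)
    moreover have "w ((b - c) * e') \<le> \<theta>" "w ((x - c) * e) \<le> \<theta>"
    proof -
      show "w ((b - c) * e') \<le> \<theta>"
        using \<theta> e'(1) bc mult_left_le[of "w e'" \<theta>] by (simp add: w_mult diff_mem valuation_ring_iff)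
      have "w (x - c) \<le> \<theta>"
        using x(2) \<theta> mult_left_le[of "\<theta> ^ n" \<theta>] by (simp add: power_le_one)
      then show "w ((x - c) * e) \<le> \<theta>"
        using e(1) bc xH mult_left_le[of "w e" "w (x - c)"]
        by (simp add: w_mult diff_mem valuation_ring_iff w_nonneg)
    qed
    ultimately have "w (y - c) \<le> w (x - c) * \<theta>"
      using bc w_diff_le[of "(b - c) * e'" "(x - c) * e"] ws
        mult_left_mono[of "w ((b - c) * e' - (x - c) * e)" \<theta> "w (x - c)"]
      by (simp add: w_mult diff_mem mult_mem inverse_mem w_inverse w_nonneg)
    also have "\<dots> \<le> \<theta> ^ Suc n * \<theta>"
      using x \<theta> by (intro mult_right_mono)
    finally have "w (y - c) \<le> \<theta> ^ Suc (Suc n)"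
      by (simp add: mult_ac)
    moreover have "y \<in> ?OL"
      unfolding y_def by (intro OL x inv_s poly_mem f) (auto intro: OL)
    ultimately show ?case
      by blast
  qed
  have "c \<in> ?L"
  proof (rule topological_closure_idem[OF K bc(2)])
    fix \<epsilon> :: real
    assume "\<epsilon> > 0"
    moreover have "(\<lambda>n. \<theta> ^ Suc n) \<longlonglongrightarrow> 0"
      using LIMSEQ_realpow_zero[OF \<theta>(1,2)] by (rule LIMSEQ_Suc)
    ultimately have "eventually (\<lambda>n. \<theta> ^ Suc n < \<epsilon>) sequentially"
      by (intro order_tendstoD)
    then obtain n where n: "\<theta> ^ Suc n < \<epsilon>"
      by (auto simp: eventually_sequentially)
    obtain x where x: "x \<in> ?OL" "w (x - c) \<le> \<theta> ^ Suc n"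
      using step by blast
    then have "x \<in> ?L"
      by (simp add: L.valuation_ring_iff)
    moreover have "x - c \<in> H"
      using \<open>x \<in> ?L\<close> bc topological_closure_subset[of K] by (intro diff_mem) auto
    then have "w (c - x) < \<epsilon>"
      using x n w_minus[of "x - c"] by simp
    ultimately show "\<exists>y\<in>?L. w (c - y) < \<epsilon>"
      by blast
  qed
  then show "\<exists>c\<in>?OL. poly f c = 0 \<and> w (c - b) < 1"
    using c by (auto simp: valuation_ring_def)
qed

end

section \<open>Values and roots in Henselizations of the base field\<close>

lemma intermediate_fieldD:
  assumes "intermediate_field L"
  shows "subfield L ring_of_type_algebra" "to_ac x \<in> L"
  using assms by (auto simp: intermediate_field_def)

lemma subfield_range_to_ac: "subfield (range to_ac) ring_of_type_algebra"
  unfolding subfield_type_iff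
  by (auto simp flip: to_ac_diff to_ac_mult to_ac_inverse to_ac_1)

text \<open>The universal property is applied to the closure of \<open>K\<close> in \<open>H\<close>
  with the same \<open>w\<close>. The resulting embedding preserves \<open>w\<close>, so
  \<open>w x\<close> is the value of a limit of elements of \<open>K\<close>.\<close>

lemma henselization_value:
  assumes "henselization a H w" "x \<in> H" "x \<noteq> 0"
  obtains k where "w x = a k"
proof -
  have ext: "henselian_extension a H w"
    and univ: "\<And>L u. henselian_extension a L u \<Longrightarrow> \<exists>\<sigma>. \<sigma> \<in> valued_embeddings H w L u"
    using assms(1) by (auto simp: henselization_def)
  have H: "intermediate_field H" "ultrametric_on H w" "henselian H w" "\<And>x. w (to_ac x) = a x"
    using ext by (auto simp: henselian_extension_def)
  interpret ultrametric_subfield H w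
    using intermediate_fieldD(1)[OF H(1)] H(2) by (rule ultrametric_subfield.intro)
  let ?L = "topological_closure (range to_ac)"
  have K: "range to_ac \<subseteq> H"
    using H(1) by (simp add: intermediate_field_def)
  have "henselian_extension a ?L w"
    unfolding henselian_extension_def intermediate_field_def
    using subfield_topological_closure[OF subfield_range_to_ac K] subset_topological_closure[OF K]
      henselian_topological_closure[OF subfield_range_to_ac K H(3)] H(4) ultrametric
      topological_closure_subset[of "range to_ac"]
    by (auto simp: ultrametric_on_def subset_iff)
  then obtain \<sigma> where "\<sigma> \<in> valued_embeddings H w ?L w"
    using univ by blast
  then have \<sigma>: "\<sigma> x \<in> ?L" "w (\<sigma> x) = w x"
    using assms(2) by (auto simp: valued_embeddings_def ring_hom_def)
  then have "\<sigma> x \<noteq> 0"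
    using w_pos[OF assms(2,3)] w_zero by auto
  then obtain k where "w (to_ac k) = w (\<sigma> x)"
    using value_of_topological_closure[OF K \<sigma>(1)] by (metis rangeE)
  then show thesis
    using that[of k] \<sigma>(2) H(4)[of k] by simp
qed

lemma henselization_root:
  assumes hens: "henselization a H w" and a: "discrete_rep a v c" and \<pi>: "\<pi> \<noteq> 0" "v \<pi> = 1"
    and y: "y \<in> H"
  defines "p \<equiv> to_ac \<pi>"
  shows "\<exists>z\<in>H. poly (specialize (split_poly p) y) z = 0"
proof -
  have H: "intermediate_field H" "ultrametric_on H w" "henselian H w" "\<And>x. w (to_ac x) = a x"
    using hens by (auto simp: henselization_def henselian_extension_def)
  interpret ultrametric_subfield H w
    using intermediate_fieldD(1)[OF H(1)] H(2) by (rule ultrametric_subfield.intro)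
  have p: "p \<in> H" "p \<noteq> 0" "w p = c powr (- 1)"
    using intermediate_fieldD(2)[OF H(1)] \<pi> a H(4) by (auto simp: p_def discrete_rep_def)
  have c: "c > 1"
    using a by (simp add: discrete_rep_def)
  have wp: "w p < 1"
    using p(3) c by (simp add: powr_minus inverse_less_1_iff)
  define B where "B = 1 + p * y\<^sup>2"
  have y2: "p * y\<^sup>2 \<in> H"
    using p y by (simp add: power2_eq_square mult_mem)
  have BH: "B \<in> H"
    using y2 by (simp add: B_def add_mem one_mem)
  \<comment> \<open>For nonzero \<open>y\<close>, \<open>w y\<close> is a value of \<open>K\<close>,
    so the exponent of \<open>c\<close> is the odd number \<open>- 1 - 2 * v k\<close>.\<close>
  have "w (p * y\<^sup>2) \<noteq> 1"
  proof (cases "y = 0")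
    case False
    then obtain k where k: "w y = a k"
      using henselization_value[OF hens y] by blast
    then have "k \<noteq> 0"
      using w_pos[OF y False] a by (auto simp: discrete_rep_def)
    then have "w y = c powr (- of_int (v k))"
      using k a by (simp add: discrete_rep_def)
    then have "w (p * y\<^sup>2) = c powr (- 1) * (c powr (- of_int (v k)) * c powr (- of_int (v k)))"
      using p y by (simp only: power2_eq_square w_mult mult_mem)
    also have "\<dots> = c powr (of_int (- 1 - 2 * v k))"
      by (simp only: powr_add[symmetric]) simp
    finally have "w (p * y\<^sup>2) = c powr (of_int (- 1 - 2 * v k))" .
    moreover have "- 1 - 2 * v k \<noteq> 0"
      by presburger
    ultimately show ?thesis
      using c by (simp only: powr_eq_one_iff of_int_eq_0_iff) simp
  qed (use w_zero in simp)
  \<comment> \<open>The summands 1 and \<open>p * y ^ 2\<close> have different sizes, so they cannot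
    cancel and \<open>w B\<close> is the larger one.\<close>
  then have wB: "w B \<ge> 1"
    using w_eq_if_less[of 1 B] w_eq_if_less[of "p * y\<^sup>2" B] w_minus y2 BH one_mem w_one
    by (auto simp: B_def not_less linorder_neq_iff minus_mem)
  then have B0: "B \<noteq> 0"
    using w_zero by auto
  define g where "g = p * inverse B"
  have gH: "g \<in> H"
    using p BH by (simp add: g_def mult_mem inverse_mem)
  have "w g = w p * inverse (w B)"
    by (simp only: g_def w_mult w_inverse inverse_mem p(1) BH)
  also have "\<dots> \<le> w p"
    using wB w_nonneg[OF p(1)] by (intro mult_left_le) (auto simp: inverse_le_1_iff)
  finally have "w g < 1"
    using wp by simp
  \<comment> \<open>Hensel's lemma is applied at the approximate root 0, where the value is
    \<open>- g\<close> and the derivative is 1.\<close>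
  let ?f = "[:- g, 1, 1:]"
  have "?f \<in> polys_over (valuation_ring H w)"
    using gH \<open>w g < 1\<close> valuation_ring_closed(1,2)
    by (auto simp: polys_over_pCons zero_in_polys_over valuation_ring_iff minus_mem w_minus)
  moreover have "w (poly ?f 0) < 1" "w (poly (pderiv ?f) 0) = 1"
    using gH \<open>w g < 1\<close> by (simp_all add: w_minus w_one pderiv_pCons)
  ultimately obtain z where z: "z \<in> valuation_ring H w" "poly ?f z = 0"
    using H(3) valuation_ring_closed(1) unfolding henselian_def by blast
  have "g = z + z * z"
    using z(2) by (simp add: algebra_simps)
  moreover have "p = g * B"
    using B0 by (simp add: g_def)
  \<comment> \<open>Scaling by \<open>B\<close> undoes the substitution
    \<open>X = B * Z\<close>.\<close>
  ultimately have "poly (specialize (split_poly p) y) (B * z) = 0"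
    unfolding specialize_split_poly B_def[symmetric] by (simp add: algebra_simps)
  moreover have "B * z \<in> H"
    using BH z by (simp add: valuation_ring_iff mult_mem)
  ultimately show ?thesis
    by blast
qed

section \<open>Square roots in real closures\<close>

text \<open>If a square root \<open>s\<close> of \<open>x\<close> were missing,
  \<open>R + R * s\<close> would be a proper extension of \<open>R\<close>. It is still formally
  real because \<open>x\<close> lies in the positive cone, which contradicts maximality.\<close>

lemma real_closed_sqrt:
  assumes R: "real_closed R" and P: "positive_cone R P" and x: "x \<in> P"
  obtains s where "s \<in> R" "s\<^sup>2 = x"
proof -
  obtain s where s: "s\<^sup>2 = x"
    using nth_root_exists[of 2 x] by auto
  have "s \<in> R"
  proof (rule ccontr)
    assume sR: "s \<notin> R"
    have IF: "intermediate_field R"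
      using R by (simp add: real_closed_def)
    have one: "1 \<in> R" and diff: "\<And>x y. x \<in> R \<Longrightarrow> y \<in> R \<Longrightarrow> x - y \<in> R"
      and mult: "\<And>x y. x \<in> R \<Longrightarrow> y \<in> R \<Longrightarrow> x * y \<in> R"
      and inv: "\<And>x. x \<in> R \<Longrightarrow> inverse x \<in> R"
      using intermediate_fieldD(1)[OF IF] by (simp_all add: subfield_type_iff)
    have zero: "0 \<in> R"
      using diff[OF one one] by simp
    have add: "x + y \<in> R" if "x \<in> R" "y \<in> R" for x y
      using diff[OF that(1) diff[OF zero that(2)]] by simp
    have xR: "x \<in> R" and Padd: "\<And>x y. x \<in> P \<Longrightarrow> y \<in> P \<Longrightarrow> x + y \<in> P"
      and Pmult: "\<And>x y. x \<in> P \<Longrightarrow> y \<in> P \<Longrightarrow> x * y \<in> P"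
      using P x by (auto simp: positive_cone_def)
    have square: "y * y \<in> P" if "y \<in> R" for y
      using P that Pmult[of y y] Pmult[of "- y" "- y"] by (auto simp: positive_cone_def)
    define L where "L = {a + b * s | a b. a \<in> R \<and> b \<in> R}"
    have L: "a + b * s \<in> L" if "a \<in> R" "b \<in> R" for a b
      using that by (auto simp: L_def)
    have "R \<subseteq> L"
      using L[OF _ zero] by auto
    moreover have "s \<in> L"
      using L[OF zero one] by simp
    ultimately have "R \<subset> L"
      using sR by blast
    have s2: "s * s = x"
      using s by (simp add: power2_eq_square)
    have "subfield L ring_of_type_algebra"
      unfolding subfield_type_iff
    proof (intro conjI ballI)
      show "1 \<in> L"
        using one \<open>R \<subseteq> L\<close> by blast
    next
      fix u v
      assume "u \<in> L" "v \<in> L"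
      then obtain a b c d where u: "u = a + b * s" "a \<in> R" "b \<in> R"
        and v: "v = c + d * s" "c \<in> R" "d \<in> R"
        by (auto simp: L_def)
      have "(a - c) + (b - d) * s \<in> L"
        using u v by (intro L diff)
      then show "u - v \<in> L"
        by (simp add: u v algebra_simps)
      have "u * v = (a * c + b * d * x) + (a * d + b * c) * s"
        by (simp add: u v algebra_simps flip: s2)
      then show "u * v \<in> L"
        using L add mult u v xR by simp
    next
      fix u
      assume "u \<in> L"
      then obtain a b where u: "u = a + b * s" "a \<in> R" "b \<in> R"
        by (auto simp: L_def)
      show "inverse u \<in> L"
      proof (cases "u = 0")
        case False
        \<comment> \<open>The norm of \<open>u\<close>; it is nonzero because \<open>s\<close> is
          not in \<open>R\<close>.\<close>
        define n where "n = a * a - b * b * x"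
        have n: "n = u * (a - b * s)"
          by (simp add: n_def u algebra_simps flip: s2)
        have "a - b * s \<noteq> 0"
        proof
          assume eq: "a - b * s = 0"
          show False
          proof (cases "b = 0")
            case True
            then show False
              using eq False u by simp
          next
            case b: False
            then have "s = a * inverse b"
              using eq by (simp add: field_simps)
            then show False
              using sR mult inv u by simp
          qed
        qed
        then have "inverse u = (a - b * s) * inverse n"
          using False by (simp add: n field_simps)
        also have "\<dots> = a * inverse n + (0 - b * inverse n) * s"
          by (simp add: algebra_simps)
        also have "n \<in> R"
          using u xR by (simp add: n_def diff mult)
        then have "a * inverse n + (0 - b * inverse n) * s \<in> L"
          using u by (intro L diff mult zero inv)
        finally show ?thesis .
      qed (use zero \<open>R \<subseteq> L\<close> in auto)
    qed
    then have "intermediate_field L"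
      using IF \<open>R \<subseteq> L\<close> by (auto simp: intermediate_field_def)
    moreover have "formally_real L"
      unfolding formally_real_def
    proof
      assume "\<exists>xs. set xs \<subseteq> L \<and> (\<Sum>x\<leftarrow>xs. x ^ 2) = -1"
      then obtain xs where xs: "set xs \<subseteq> L" "(\<Sum>x\<leftarrow>xs. x ^ 2) = -1"
        by blast
      \<comment> \<open>The invariant is that the component in \<open>R\<close> of a sum of squares
        lies in \<open>P\<close>: each square contributes \<open>c * c + d * d * x\<close>. For the
        sum -1 this puts -1 into \<open>P\<close>.\<close>
      have "\<exists>a\<in>P. \<exists>b\<in>R. (\<Sum>x\<leftarrow>xs. x ^ 2) = a + b * s"
        using xs(1)
      proof (induction xs)
        case Nil
        then show ?case
          using zero square[OF zero] by (auto intro!: bexI[of _ 0])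
      next
        case (Cons u xs)
        then obtain a b where ab: "a \<in> P" "b \<in> R" "(\<Sum>x\<leftarrow>xs. x ^ 2) = a + b * s"
          by auto
        obtain c d where u: "u = c + d * s" "c \<in> R" "d \<in> R"
          using Cons.prems by (auto simp: L_def)
        have "(\<Sum>x\<leftarrow>u # xs. x ^ 2) = u\<^sup>2 + (a + b * s)"
          using ab(3) by simp
        also have "u\<^sup>2 = c * c + d * d * x + (c * d + c * d) * s"
          by (simp add: u power2_eq_square algebra_simps flip: s2)
        finally have "(\<Sum>x\<leftarrow>u # xs. x ^ 2) = (a + (c * c + d * d * x)) + (b + (c * d + c * d)) * s"
          by (simp only: distrib_right distrib_left ac_simps)
        moreover have "a + (c * c + d * d * x) \<in> P" "b + (c * d + c * d) \<in> R"
          using ab u x by (blast intro: Padd Pmult square add mult)+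
        ultimately show ?case
          by blast
      qed
      then obtain a b where ab: "a \<in> P" "b \<in> R" "a + b * s = - 1"
        using xs(2) by auto
      have PR: "P \<subseteq> R"
        using P by (simp add: positive_cone_def)
      have "b = 0"
      proof (rule ccontr)
        assume "b \<noteq> 0"
        have "b * s = 0 - 1 - a"
          using ab(3) by (simp add: algebra_simps)
        then have "s = (0 - 1 - a) * inverse b"
          using \<open>b \<noteq> 0\<close> by (simp add: field_simps)
        moreover have "(0 - 1 - a) * inverse b \<in> R"
          using ab PR by (intro mult diff inv zero one) auto
        ultimately show False
          using sR by simp
      qed
      then have "- 1 \<in> P"
        using ab by simp
      moreover have "1 \<in> P"
        using square[OF one] by simp
      ultimately show False
        using P by (auto simp: positive_cone_def)
    qed
    ultimately show False
      using R \<open>R \<subset> L\<close> by (auto simp: real_closed_def)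
  qed
  then show thesis
    using s that by blast
qed

text \<open>The quadratic formula applies, since the discriminant lies in the positive cone and 2 is
  invertible.\<close>

lemma real_closure_root:
  assumes R: "real_closure a R" and \<pi>: "\<pi> \<in> induced_nonneg a" and y: "y \<in> R"
  defines "p \<equiv> to_ac \<pi>"
  shows "\<exists>z\<in>R. poly (specialize (split_poly p) y) z = 0"
proof -
  obtain P where RC: "real_closed R" and P: "positive_cone R P"
    and ext: "\<And>x. to_ac x \<in> P \<longleftrightarrow> x \<in> induced_nonneg a"
    using R by (auto simp: real_closure_def)
  have IF: "intermediate_field R" and real: "formally_real R"
    using RC by (auto simp: real_closed_def)
  have diff: "\<And>x y. x \<in> R \<Longrightarrow> y \<in> R \<Longrightarrow> x - y \<in> R"
    and mult: "\<And>x y. x \<in> R \<Longrightarrow> y \<in> R \<Longrightarrow> x * y \<in> R"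
    and inv: "\<And>x. x \<in> R \<Longrightarrow> inverse x \<in> R" and one: "1 \<in> R"
    using intermediate_fieldD(1)[OF IF] by (simp_all add: subfield_type_iff)
  have Padd: "\<And>x y. x \<in> P \<Longrightarrow> y \<in> P \<Longrightarrow> x + y \<in> P"
    and Pmult: "\<And>x y. x \<in> P \<Longrightarrow> y \<in> P \<Longrightarrow> x * y \<in> P" and PR: "P \<subseteq> R"
    using P by (auto simp: positive_cone_def)
  have square: "y * y \<in> P" if "y \<in> R" for y
    using P that Pmult[of y y] Pmult[of "- y" "- y"] by (auto simp: positive_cone_def)
  have "p \<in> P"
    using ext \<pi> by (simp add: p_def)
  define B where "B = 1 + p * y\<^sup>2"
  have B: "B \<in> P"
    using square[OF one] square[OF y] \<open>p \<in> P\<close> by (simp add: B_def power2_eq_square Padd Pmult)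
  \<comment> \<open>The discriminant \<open>B ^ 2 + 4 * p * B\<close>, with the multiple written as
    repeated addition so that closure of \<open>P\<close> under sums applies.\<close>
  have "B * B + (p * B + p * B + (p * B + p * B)) \<in> P"
    using B \<open>p \<in> P\<close> by (intro Padd Pmult)
  then obtain s where s: "s \<in> R" "s\<^sup>2 = B * B + (p * B + p * B + (p * B + p * B))"
    using real_closed_sqrt[OF RC P] by blast
  \<comment> \<open>If 2 vanished, the single square of 1 would equal -1.\<close>
  have two: "(2 :: 'a alg_closure) \<noteq> 0"
  proof
    assume "(2 :: 'a alg_closure) = 0"
    then have "(1 :: 'a alg_closure) + 1 = 0"
      by simp
    then have "(\<Sum>x\<leftarrow>[1 :: 'a alg_closure]. x ^ 2) = - 1"
      by (simp only: eq_neg_iff_add_eq_0) simp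
    moreover have "set [1] \<subseteq> R"
      using one by simp
    ultimately show False
      using real unfolding formally_real_def by blast
  qed
  have "2 \<in> R"
    using square[OF one] PR Padd[of 1 1] by auto
  define z where "z = (s - B) * inverse 2"
  have "2 * z = s - B"
    using two by (simp add: z_def)
  have "2 * 2 * poly (specialize (split_poly p) y) z
      = (2 * z) * (2 * z) + 2 * B * (2 * z) - 2 * 2 * (p * B)"
    unfolding specialize_split_poly B_def[symmetric] by (simp add: algebra_simps)
  also have "\<dots> = 0"
    unfolding \<open>2 * z = s - B\<close> using s(2) by (simp add: power2_eq_square algebra_simps)
  finally have "poly (specialize (split_poly p) y) z = 0"
    using two by (metis mult_eq_0_iff)
  moreover have "z \<in> R"
    unfolding z_def using s(1) B PR \<open>2 \<in> R\<close> by (intro mult diff inv) auto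
  ultimately show ?thesis
    by blast
qed

section \<open>From local roots to reducibility over the totally split field\<close>

theorem theorem1:
  fixes S :: "('k::field \<Rightarrow> real) set"
  assumes "finite S"
    and "\<And>a. a \<in> S \<Longrightarrow> absolute_value a"
    and "\<And>a. a \<in> S \<Longrightarrow> real_archimedean a \<or> ultrametric_discrete a"
  shows "\<not> hilbertian (K_tot S)"
proof
  let ?F = "K_tot S"
  assume hilb: "hilbertian ?F"
  obtain \<pi> where \<pi>: "\<pi> \<noteq> 0" "\<And>a. a \<in> S \<Longrightarrow> uniformizes a \<pi>"
    using ex_uniformizer[OF assms] by blast
  define p where "p = to_ac \<pi>"
  have p0: "p \<noteq> 0"
    using \<pi>(1) by (simp add: p_def)
  have F: "subfield ?F ring_of_type_algebra" and pF: "p \<in> ?F"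
    using intermediate_fieldD[OF intermediate_field_K_tot] by (auto simp: p_def)
  have one: "1 \<in> ?F" and diff: "\<And>x y. x \<in> ?F \<Longrightarrow> y \<in> ?F \<Longrightarrow> x - y \<in> ?F"
    using F by (simp_all add: subfield_type_iff)
  have zero: "0 \<in> ?F"
    using diff[OF one one] by simp
  have minus: "- x \<in> ?F" if "x \<in> ?F" for x
    using diff[OF zero that] by simp
  have pm: "- (p * p) \<in> ?F"
    using F pF by (intro minus) (simp add: subfield_type_iff)
  have "split_poly p \<in> polys_over (polys_over ?F)"
    using one zero pF pm minus[OF pF]
    by (simp add: split_poly_def split_base_def polys_over_pCons zero_in_polys_over one_in_polys_over)
  then obtain y where y: "y \<in> ?F"
    "ring_irreducible\<^bsub>ring_on (polys_over ?F)\<^esub> (specialize (split_poly p) y)"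
    using hilb split_poly_irreducible[OF p0 zero] separable_split_poly[OF p0]
    unfolding hilbertian_def by blast
  let ?f = "specialize (split_poly p) y"
  define B where "B = 1 + p * y\<^sup>2"
  have f: "?f = [:- (p * B), B, 1:]"
    by (simp add: specialize_split_poly B_def)
  have root: "\<exists>z\<in>M. poly ?f z = 0" if a: "a \<in> S" and M: "M \<in> local_closures a" for a M
  proof -
    have yM: "y \<in> M"
      using y(1) a M by (auto simp: K_tot_def)
    from M consider (hens) w where "ultrametric_discrete a" "henselization a M w"
      | (real) "real_archimedean a" "real_closure a M"
      by (auto simp: local_closures_def)
    then show ?thesis
    proof cases
      case hens
      then obtain v c where "discrete_rep a v c"
        by (auto simp: ultrametric_discrete_iff)
      then show ?thesis
        unfolding p_def using henselization_root hens \<pi> a yM by (metis uniformizes_def)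
    next
      case real
      then obtain \<phi> where \<phi>: "induced_by \<phi> a"
        by (auto simp: real_archimedean_def)
      then have "0 < \<phi> \<pi>"
        using \<pi>(2)[OF a] by (simp add: uniformizes_def)
      with \<phi> have "\<pi> \<in> induced_nonneg a"
        unfolding induced_nonneg_def by (blast intro: less_imp_le)
      then show ?thesis
        unfolding p_def using real_closure_root[OF real(2)] yM by blast
    qed
  qed
  \<comment> \<open>One root \<open>s\<close> is fixed in the algebraic closure; different local
    closures may contribute different roots a priori.\<close>
  have "Polynomial.degree ?f > 0"
    by (simp add: f)
  then obtain s where s: "poly ?f s = 0"
    using alg_closed_imp_poly_has_root by blast
  define t where "t = - B - s"
  have st: "?f = [:s * t, - (s + t), 1:]"
    using s by (simp add: f t_def algebra_simps)
  have BF: "B \<in> ?F"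
    using F pF y(1) diff[OF one, of "- (p * y\<^sup>2)"] minus[of "p * y\<^sup>2"]
    by (simp add: B_def subfield_type_iff power2_eq_square)
  \<comment> \<open>The local root is \<open>s\<close> or \<open>t\<close>; as the sum of the roots
    is \<open>- B\<close>, which lies in \<open>M\<close>, either one brings the other into
    \<open>M\<close>.\<close>
  have "s \<in> M" if a: "a \<in> S" and M: "M \<in> local_closures a" for a M
  proof -
    obtain z where z: "z \<in> M" "poly ?f z = 0"
      using root[OF a M] by blast
    have "poly ?f z = (z - s) * (z - t)"
      by (simp add: st algebra_simps)
    then have "s = z \<or> s = 0 - B - z"
      using z(2) by (auto simp: t_def)
    moreover have "B \<in> M"
      using BF a M by (auto simp: K_tot_def)
    then have "0 - B - z \<in> M"
      using intermediate_fieldD(1)[OF local_closures_intermediate[OF M]] z(1)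
      by (metis subfield_type_iff diff_self)
    ultimately show ?thesis
      using z(1) by auto
  qed
  then have sF: "s \<in> ?F"
    by (auto simp: K_tot_def)
  then have "t \<in> ?F"
    using diff minus[OF BF] by (simp add: t_def)
  then have "\<not> ring_irreducible\<^bsub>ring_on (polys_over ?F)\<^esub> ?f"
    unfolding st using zero one sF minus by (intro quadratic_not_irreducible) auto
  then show False
    using y(2) by simp
qed

end
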